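(* Let $\mathbf{k}$ be an algebraically closed field with $\operatorname{char}(\mathbf{k})=2$, let $a_1,\dots,a_n$ be non-negative integers, and let \[M_{\underline a}=\mathbf{k}[T_1,\dots,T_n]/\langle T_1^{1+a_1},\dots,T_n^{1+a_n}\rangle.\] The Weak Lefschetz Property holds for $M_{\underline a}$ if and only if \[\sum_{i=1}^n\theta_q(a_i)\leq 2q-2\quad\text{for all }q=2^k,\ k\ge1,\text{ with }2q>a_1\oplus a_2\oplus\cdots\oplus a_n.\]
   Context: $M_{\underline a}$ is standard graded ($\deg T_i=1$). A standard graded Artinian algebra $A$ has the Weak Lefschetz Property if for a generic linear form $\ell\in A_1$ all multiplication maps $A_d\xrightarrow{\times\ell}A_{d+1}$ have maximal rank. The Nim-sum $a\oplus b$ of non-negative integers is obtained by adding modulo $2$ the corresponding binary digits. For $x\in\mathbb{Z}$ and $q=2^k$ with $k\ge1$, write $x=2qm+r$ with $0\le r<2q$ and define \[\theta_q(x)=\begin{cases}r&\text{if }r\le q-1,\\ 2q-2-r&\text{if }q-1\le r\le 2q-2,\\ -\infty&\text{if }r=2q-1.\end{cases}\] *)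

theory Defs
  imports
    "HOL-Library.Poly_Mapping"
    "HOL-Library.Extended_Real"
    "HOL-Computational_Algebra.Computational_Algebra"
    "HOL-Algebra.QuotRing"
    "HOL-Algebra.Embedded_Algebras"
begin

section \<open>Polynomial rings\<close>

text \<open>
  A polynomial is a finitely supported map from monomials to coefficients, and a monomial is a
  finitely supported map from variable indices to exponents; multiplication is the convolution
  product of \<^theory>\<open>HOL-Library.Poly_Mapping\<close>. The type has a variable for every
  natural number, so \<open>k[T\<^sub>i | i \<in> V]\<close> is cut out by its carrier.
\<close>

type_synonym 'k mpoly = "(nat \<Rightarrow>\<^sub>0 nat) \<Rightarrow>\<^sub>0 'k"

definition mpoly_ring :: "nat set \<Rightarrow> 'k::comm_ring_1 mpoly ring" where
  "mpoly_ring V =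
    \<lparr> carrier = {p. \<forall>m \<in> Poly_Mapping.keys p. Poly_Mapping.keys m \<subseteq> V},
      mult = (*), one = 1, zero = 0, add = (+) \<rparr>"

definition mpoly_var :: "nat \<Rightarrow> 'k::comm_ring_1 mpoly" where
  "mpoly_var i = Poly_Mapping.single (Poly_Mapping.single i 1) 1"

definition mpoly_const :: "'k::comm_ring_1 \<Rightarrow> 'k mpoly" where
  "mpoly_const c = Poly_Mapping.single 0 c"

definition monomial_degree :: "(nat \<Rightarrow>\<^sub>0 nat) \<Rightarrow> nat" where
  "monomial_degree m = (\<Sum>i \<in> Poly_Mapping.keys m. Poly_Mapping.lookup m i)"

definition homogeneous :: "nat \<Rightarrow> 'k::comm_ring_1 mpoly \<Rightarrow> bool" where
  "homogeneous d p \<longleftrightarrow> (\<forall>m \<in> Poly_Mapping.keys p. monomial_degree m = d)"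

lemma mpoly_ring_cring: "cring (mpoly_ring V :: 'k::comm_ring_1 mpoly ring)"
proof -
  define C where "C = carrier (mpoly_ring V :: 'k mpoly ring)"
  have C: "p \<in> C \<longleftrightarrow> (\<forall>m \<in> Poly_Mapping.keys p. Poly_Mapping.keys m \<subseteq> V)" for p :: "'k mpoly"
    by (simp add: C_def mpoly_ring_def)
  have zero: "0 \<in> C" and one: "1 \<in> C"
    by (simp_all add: C)
  have add: "p + q \<in> C" if "p \<in> C" "q \<in> C" for p q :: "'k mpoly"
    using that Poly_Mapping.keys_add[of p q] unfolding C by blast
  have mult: "p * q \<in> C" if "p \<in> C" "q \<in> C" for p q :: "'k mpoly"
    unfolding C
  proof
    fix m assume "m \<in> Poly_Mapping.keys (p * q)"
    then obtain m1 m2 where m: "m = m1 + m2" "m1 \<in> Poly_Mapping.keys p" "m2 \<in> Poly_Mapping.keys q"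
      using Poly_Mapping.keys_mult[of p q] by blast
    then have "Poly_Mapping.keys m1 \<subseteq> V" "Poly_Mapping.keys m2 \<subseteq> V"
      using that unfolding C by blast+
    then show "Poly_Mapping.keys m \<subseteq> V"
      using m(1) Poly_Mapping.keys_add[of m1 m2] by blast
  qed
  have neg: "\<exists>q \<in> C. p + q = 0" if "p \<in> C" for p :: "'k mpoly"
    by (rule bexI[of _ "- p"]) (use that in \<open>simp_all add: C\<close>)
  have R: "(mpoly_ring V :: 'k mpoly ring) =
      \<lparr> carrier = C, mult = (*), one = 1, zero = 0, add = (+) \<rparr>"
    unfolding C_def by (simp add: mpoly_ring_def)
  show ?thesis
    unfolding R
  proof (rule cringI)
    show "abelian_group \<lparr> carrier = C, mult = (*), one = 1, zero = 0, add = (+) \<rparr>"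
      by (rule abelian_groupI) (simp_all add: zero add neg ac_simps)
    show "comm_monoid \<lparr> carrier = C, mult = (*), one = 1, zero = 0, add = (+) \<rparr>"
      by (rule comm_monoidI) (simp_all add: one mult ac_simps)
  qed (simp add: distrib_right)
qed


section \<open>The Weak Lefschetz Property\<close>

text \<open>
  Let \<open>A\<close> be an algebra over its subfield \<open>K\<close>. The polynomial functions on a \<open>K\<close>-subspace \<open>V\<close>
  of \<open>A\<close> are the elements of the algebra of functions generated by the constants and the
  \<open>K\<close>-linear functionals. Only their values on \<open>V\<close> are relevant.
\<close>

definition linear_functional ::
    "('a, 'b) ring_scheme \<Rightarrow> 'a set \<Rightarrow> 'a set \<Rightarrow> ('a \<Rightarrow> 'a) \<Rightarrow> bool" where
  "linear_functional A K V \<phi> \<longleftrightarrow>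
    \<phi> \<in> V \<rightarrow> K \<and>
    (\<forall>u \<in> V. \<forall>v \<in> V. \<phi> (u \<oplus>\<^bsub>A\<^esub> v) = \<phi> u \<oplus>\<^bsub>A\<^esub> \<phi> v) \<and>
    (\<forall>c \<in> K. \<forall>v \<in> V. \<phi> (c \<otimes>\<^bsub>A\<^esub> v) = c \<otimes>\<^bsub>A\<^esub> \<phi> v)"

inductive_set polynomial_functions ::
    "('a, 'b) ring_scheme \<Rightarrow> 'a set \<Rightarrow> 'a set \<Rightarrow> ('a \<Rightarrow> 'a) set"
  for A :: "('a, 'b) ring_scheme" and K V :: "'a set" where
  const: "c \<in> K \<Longrightarrow> (\<lambda>_. c) \<in> polynomial_functions A K V"
| linear: "linear_functional A K V \<phi> \<Longrightarrow> \<phi> \<in> polynomial_functions A K V"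
| add: "\<lbrakk> F \<in> polynomial_functions A K V; G \<in> polynomial_functions A K V \<rbrakk>
    \<Longrightarrow> (\<lambda>v. F v \<oplus>\<^bsub>A\<^esub> G v) \<in> polynomial_functions A K V"
| mult: "\<lbrakk> F \<in> polynomial_functions A K V; G \<in> polynomial_functions A K V \<rbrakk>
    \<Longrightarrow> (\<lambda>v. F v \<otimes>\<^bsub>A\<^esub> G v) \<in> polynomial_functions A K V"

definition zariski_closed ::
    "('a, 'b) ring_scheme \<Rightarrow> 'a set \<Rightarrow> 'a set \<Rightarrow> 'a set \<Rightarrow> bool" where
  "zariski_closed A K V Z \<longleftrightarrow>
    (\<exists>S \<subseteq> polynomial_functions A K V. Z = {v \<in> V. \<forall>F \<in> S. F v = \<zero>\<^bsub>A\<^esub>})"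

text \<open>A property holds generically on \<open>V\<close> if it holds on a nonempty Zariski open subset of \<open>V\<close>.\<close>

definition generically ::
    "('a, 'b) ring_scheme \<Rightarrow> 'a set \<Rightarrow> 'a set \<Rightarrow> ('a \<Rightarrow> bool) \<Rightarrow> bool" where
  "generically A K V P \<longleftrightarrow>
    (\<exists>U \<subseteq> V. zariski_closed A K V (V - U) \<and> U \<noteq> {} \<and> (\<forall>v \<in> U. P v))"

definition max_rank ::
    "('a, 'b) ring_scheme \<Rightarrow> 'a set \<Rightarrow> 'a set \<Rightarrow> 'a set \<Rightarrow> ('a \<Rightarrow> 'a) \<Rightarrow> bool" where
  "max_rank A K V W f \<longleftrightarrow>
    ring.dim A K (f ` V) = min (ring.dim A K V) (ring.dim A K W)"

text \<open>Here \<open>G d\<close> is the degree \<open>d\<close> component of the standard graded Artinian \<open>K\<close>-algebra \<open>A\<close>.\<close>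

definition weak_lefschetz ::
    "('a, 'b) ring_scheme \<Rightarrow> 'a set \<Rightarrow> (nat \<Rightarrow> 'a set) \<Rightarrow> bool" where
  "weak_lefschetz A K G \<longleftrightarrow>
    generically A K (G 1)
      (\<lambda>l. \<forall>d. max_rank A K (G d) (G (d + 1)) (\<lambda>x. l \<otimes>\<^bsub>A\<^esub> x))"


section \<open>Monomial complete intersections\<close>

definition mci_ideal :: "nat \<Rightarrow> (nat \<Rightarrow> nat) \<Rightarrow> 'k::comm_ring_1 mpoly set" where
  "mci_ideal n a =
    genideal (mpoly_ring {1..n}) ((\<lambda>i. mpoly_var i ^ (1 + a i)) ` {1..n})"

definition mci_ring :: "nat \<Rightarrow> (nat \<Rightarrow> nat) \<Rightarrow> 'k::comm_ring_1 mpoly set ring" where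
  "mci_ring n a = mpoly_ring {1..n} Quot mci_ideal n a"

definition mci_class :: "nat \<Rightarrow> (nat \<Rightarrow> nat) \<Rightarrow> 'k::comm_ring_1 mpoly \<Rightarrow> 'k mpoly set" where
  "mci_class n a p = mci_ideal n a +>\<^bsub>mpoly_ring {1..n}\<^esub> p"

definition mci_scalars :: "nat \<Rightarrow> (nat \<Rightarrow> nat) \<Rightarrow> 'k::comm_ring_1 mpoly set set" where
  "mci_scalars n a = (\<lambda>c. mci_class n a (mpoly_const c)) ` UNIV"

definition mci_component ::
    "nat \<Rightarrow> (nat \<Rightarrow> nat) \<Rightarrow> nat \<Rightarrow> 'k::comm_ring_1 mpoly set set" where
  "mci_component n a d =
    mci_class n a ` {p \<in> carrier (mpoly_ring {1..n}). homogeneous d p}"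


section \<open>Nim-sums and the functions \<open>\<theta>\<^sub>q\<close>\<close>

definition nim_sum :: "nat \<Rightarrow> (nat \<Rightarrow> nat) \<Rightarrow> nat" where
  "nim_sum n a = foldr xor (map a [1..<Suc n]) 0"

definition theta :: "int \<Rightarrow> int \<Rightarrow> ereal" where
  "theta q x =
    (let r = x mod (2 * q) in
      if r \<le> q - 1 then ereal (of_int r)
      else if r \<le> 2 * q - 2 then ereal (of_int (2 * q - 2 - r))
      else - \<infinity>)"

end

theory Submission
  imports Defs
begin

text \<open>
  Since \<open>M\<close> is Gorenstein with socle degree \<open>N = \<Sum> a\<^sub>i\<close>, a linear form \<open>l\<close> has maximal rank in all
  degrees iff it is injective in the degrees below \<open>N/2\<close>; rescaling the variables shows that it does
  not matter which \<open>l = \<Sum> c\<^sub>i T\<^sub>i\<close> with all \<open>c\<^sub>i \<noteq> 0\<close> is taken.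
  Let \<open>q\<close> be a power of two with \<open>a\<^sub>i < 2q\<close> for all \<open>i\<close>.
  If one exponent is at least the sum of the others, then \<open>l\<close> is injective below the middle, because
  \<open>l\<close> is monic in that variable. If \<open>l\<^sup>q T\<^sub>i\<^sup>s = 0\<close> and \<open>2(s + q - 1) < N\<close>, then the last nonzero
  \<open>l\<^sup>j T\<^sub>i\<^sup>s\<close> is a kernel element below the middle. Finally, for \<open>N \<le> 4q - 2\<close>, the simultaneous
  replacement of two exponents \<open>a\<^sub>i, a\<^sub>j \<ge> q\<close> by \<open>2q - 2 - a\<^sub>i, 2q - 2 - a\<^sub>j\<close> preserves injectivity below
  the middle. For powers of two \<open>q' \<le> q\<close> it also preserves the values of \<open>\<theta>\<^sub>q\<^sub>'\<close> and, unless one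
  of them is \<open>-\<infinity>\<close>, the validity of \<open>2q' > a\<^sub>1 \<oplus> \<dots> \<oplus> a\<^sub>n\<close>. Induction on \<open>q\<close> and \<open>N\<close> gives
  the theorem.
\<close>

section \<open>Polynomials, graded pieces and monomial ideals\<close>

text \<open>The two criteria for l leave no gap. When a_i >= q is the only exponent of that size and
  a_i < 2q - 1, \<theta> at q is 2q - 2 - a_i on it and the identity on the others, so the
  inequality at q reads N \<le> 2 a_i. This is the hypothesis of the injectivity criterion, and its
  negation is what the kernel element needs for s = a_i + 1 - q. At smaller powers q' the leading
  digit of a_i has no partner, so the Nim-sum is at least q >= 2q' and nothing is required: this is
  the role of the side condition. Exponents are flipped in pairs for two reasons. Above the digits
  of q' a flip is a complement, and two complements cancel in the parity. On the algebraic side, the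
  kernel element moves by 2q - (a_i + 1) - (a_j + 1) degrees while N changes by twice that amount,
  so the distance to the middle is kept. The construction is ambiguous by multiples of l^(2q-1),
  which are harmless below the middle if N \<le> 4q - 2. Beyond that bound l is never injective
  below the middle, because l^(2q) = 0.\<close>

abbreviation monom_at :: "nat \<Rightarrow> nat \<Rightarrow> 'k::comm_ring_1 \<Rightarrow> 'k mpoly" where
  "monom_at i s u \<equiv> Poly_Mapping.single (Poly_Mapping.single i s) u"

definition monomial_ideal :: "nat set \<Rightarrow> (nat \<Rightarrow> nat) \<Rightarrow> 'k::comm_ring_1 mpoly set" where
  "monomial_ideal D b = {p. \<forall>m \<in> Poly_Mapping.keys p. \<exists>h\<in>D. b h \<le> Poly_Mapping.lookup m h}"

text \<open>The degree is an integer so that degrees of cofactors can be written as differences; in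
  negative degree only 0 remains.\<close>

definition piece :: "nat set \<Rightarrow> int \<Rightarrow> 'k::comm_ring_1 mpoly set" where
  "piece V D = {p. \<forall>m \<in> Poly_Mapping.keys p. Poly_Mapping.keys m \<subseteq> V \<and> int (monomial_degree m) = D}"

definition linear_form :: "nat set \<Rightarrow> (nat \<Rightarrow> 'k::comm_ring_1) \<Rightarrow> 'k mpoly" where
  "linear_form V c = (\<Sum>i\<in>V. monom_at i 1 (c i))"

lemma lookup_single_mult:
  fixes p :: "'a::cancel_comm_monoid_add \<Rightarrow>\<^sub>0 'b::comm_ring_1"
  shows "Poly_Mapping.lookup (Poly_Mapping.single k u * p) (k + m) = u * Poly_Mapping.lookup p m"
  by (simp add: lookup_mult lookup_single when_mult)

lemma keys_single_mult_subset:
  fixes p :: "'a::cancel_comm_monoid_add \<Rightarrow>\<^sub>0 'b::comm_ring_1"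
  shows "Poly_Mapping.keys (Poly_Mapping.single k u * p) \<subseteq> (+) k ` Poly_Mapping.keys p"
  using keys_mult[of "Poly_Mapping.single k u" p] by (auto split: if_splits)

lemma keys_single_mult:
  fixes p :: "'a::cancel_comm_monoid_add \<Rightarrow>\<^sub>0 'b::idom"
  assumes "u \<noteq> 0"
  shows "Poly_Mapping.keys (Poly_Mapping.single k u * p) = (+) k ` Poly_Mapping.keys p"
  using keys_single_mult_subset[of k u p] assms
  by (auto simp: in_keys_iff lookup_single_mult)

lemma monomial_degree_alt:
  assumes "finite S" "Poly_Mapping.keys m \<subseteq> S"
  shows "monomial_degree m = (\<Sum>i\<in>S. Poly_Mapping.lookup m i)"
  unfolding monomial_degree_def
  by (rule sum.mono_neutral_left) (use assms in \<open>auto simp: in_keys_iff\<close>)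

lemma monomial_degree_add [simp]: "monomial_degree (m + m') = monomial_degree m + monomial_degree m'"
  using monomial_degree_alt[of "Poly_Mapping.keys m \<union> Poly_Mapping.keys m'" "m + m'"]
    monomial_degree_alt[of "Poly_Mapping.keys m \<union> Poly_Mapping.keys m'" "m"]
    monomial_degree_alt[of "Poly_Mapping.keys m \<union> Poly_Mapping.keys m'" "m'"]
    Poly_Mapping.keys_add[of m m']
  by (simp add: lookup_add sum.distrib)

lemma monomial_degree_zero [simp]: "monomial_degree 0 = 0"
  by (simp add: monomial_degree_def)

lemma monomial_degree_single [simp]: "monomial_degree (Poly_Mapping.single i s) = s"
  by (simp add: monomial_degree_def)

lemma keys_add_nat:
  "Poly_Mapping.keys (m + m' :: 'a \<Rightarrow>\<^sub>0 nat) = Poly_Mapping.keys m \<union> Poly_Mapping.keys m'"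
  by (auto simp: in_keys_iff lookup_add)

lemma lookup_le_monomial_degree: "Poly_Mapping.lookup m i \<le> monomial_degree m"
proof (cases "i \<in> Poly_Mapping.keys m")
  case True
  then show ?thesis unfolding monomial_degree_def by (intro member_le_sum) auto
qed (simp add: in_keys_iff)

lemma piece_zero [simp]: "0 \<in> piece V D"
  by (simp add: piece_def)

lemma piece_add: "p \<in> piece V D \<Longrightarrow> q \<in> piece V D \<Longrightarrow> p + q \<in> piece V D"
  unfolding piece_def using Poly_Mapping.keys_add[of p q] by blast

lemma piece_uminus: "p \<in> piece V D \<Longrightarrow> - p \<in> piece V D"
  by (simp add: piece_def)

lemma piece_diff: "p \<in> piece V D \<Longrightarrow> q \<in> piece V D \<Longrightarrow> p - q \<in> piece V D"
  using piece_add[of p V D "- q"] piece_uminus[of q V D] by simp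

lemma piece_sum: "(\<And>i. i \<in> S \<Longrightarrow> f i \<in> piece V D) \<Longrightarrow> sum f S \<in> piece V D"
  by (induction S rule: infinite_finite_induct) (auto intro: piece_add)

lemma piece_mult:
  assumes "p \<in> piece V D" "q \<in> piece V E" shows "p * q \<in> piece V (D + E)"
  using assms keys_mult[of p q] unfolding piece_def
  by (fastforce simp: keys_add_nat)

lemma piece_mult':
  "p \<in> piece V D \<Longrightarrow> q \<in> piece V E \<Longrightarrow> F = D + E \<Longrightarrow> p * q \<in> piece V F"
  using piece_mult by blast

lemma piece_monom_at: "i \<in> V \<Longrightarrow> D = int s \<Longrightarrow> monom_at i s u \<in> piece V D"
  by (simp add: piece_def)

lemma piece_one: "1 \<in> piece V 0"
  by (simp add: piece_def)

lemma piece_linear_form: "linear_form V c \<in> piece V 1"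
  unfolding linear_form_def by (intro piece_sum piece_monom_at) auto

lemma piece_linear_form_power: "linear_form V c ^ s \<in> piece V (int s)"
proof (induction s)
  case (Suc s)
  show ?case
    by (simp, rule piece_mult'[OF piece_linear_form Suc]) simp
qed (simp add: piece_one)

lemma monomial_ideal_zero [simp]: "0 \<in> monomial_ideal D b"
  by (simp add: monomial_ideal_def)

lemma monomial_ideal_add:
  "p \<in> monomial_ideal D b \<Longrightarrow> q \<in> monomial_ideal D b \<Longrightarrow> p + q \<in> monomial_ideal D b"
  unfolding monomial_ideal_def using Poly_Mapping.keys_add[of p q] by blast

lemma monomial_ideal_uminus: "p \<in> monomial_ideal D b \<Longrightarrow> - p \<in> monomial_ideal D b"
  by (simp add: monomial_ideal_def)

lemma monomial_ideal_diff:
  "p \<in> monomial_ideal D b \<Longrightarrow> q \<in> monomial_ideal D b \<Longrightarrow> p - q \<in> monomial_ideal D b"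
  using monomial_ideal_add[of p D b "- q"] monomial_ideal_uminus[of q D b] by simp

lemma monomial_ideal_sum:
  "(\<And>i. i \<in> S \<Longrightarrow> f i \<in> monomial_ideal D b) \<Longrightarrow> sum f S \<in> monomial_ideal D b"
  by (induction S rule: infinite_finite_induct) (auto intro: monomial_ideal_add)

lemma monomial_ideal_mult: 
  assumes "p \<in> monomial_ideal D b" shows "q * p \<in> monomial_ideal D b"
proof -
  have "\<exists>h\<in>D. b h \<le> Poly_Mapping.lookup m h" if "m \<in> Poly_Mapping.keys (q * p)" for m
  proof -
    obtain m1 m2 where m: "m = m1 + m2" "m2 \<in> Poly_Mapping.keys p"
      using keys_mult[of q p] \<open>m \<in> Poly_Mapping.keys (q * p)\<close> by blast
    then show ?thesis using assms unfolding monomial_ideal_def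
      by (auto simp: lookup_add intro: trans_le_add2)
  qed
  then show ?thesis by (simp add: monomial_ideal_def)
qed

lemma monomial_ideal_mono: "D \<subseteq> E \<Longrightarrow> p \<in> monomial_ideal D b \<Longrightarrow> p \<in> monomial_ideal E b"
  unfolding monomial_ideal_def by blast

lemma monomial_ideal_cong:
  "(\<And>h. h \<in> D \<Longrightarrow> b h = b' h) \<Longrightarrow> monomial_ideal D b = monomial_ideal D b'"
  unfolding monomial_ideal_def by auto

lemma monom_at_in_monomial_ideal: "h \<in> D \<Longrightarrow> b h \<le> s \<Longrightarrow> monom_at h s u \<in> monomial_ideal D b"
  unfolding monomial_ideal_def by (auto split: if_splits intro!: bexI[of _ h])

text \<open>A power of a variable outside \<open>D\<close> is a nonzerodivisor modulo the ideal: it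
  shifts supports without touching any exponent that the ideal tests.\<close>

lemma monomial_ideal_cancel:
  fixes u :: "'k::idom"
  assumes "u \<noteq> 0" "i \<notin> D" "monom_at i s u * p \<in> monomial_ideal D b"
  shows "p \<in> monomial_ideal D b"
proof -
  have "\<exists>h\<in>D. b h \<le> Poly_Mapping.lookup m h" if "m \<in> Poly_Mapping.keys p" for m
  proof -
    have "Poly_Mapping.single i s + m \<in> Poly_Mapping.keys (monom_at i s u * p)"
      using assms(1) that by (simp add: keys_single_mult)
    then obtain h where "h \<in> D" "b h \<le> Poly_Mapping.lookup (Poly_Mapping.single i s + m) h"
      using assms(3) unfolding monomial_ideal_def by blast
    then show ?thesis using assms(2) 
      by (intro bexI[of _ h]) (auto simp: lookup_add lookup_single when_def split: if_splits)
  qed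
  then show ?thesis by (simp add: monomial_ideal_def)
qed

lemma poly_mapping_sum_single:
  "(\<Sum>m\<in>Poly_Mapping.keys p. Poly_Mapping.single m (Poly_Mapping.lookup p m)) = p"
  by (rule poly_mapping_eqI)
    (auto simp: lookup_sum lookup_single when_def in_keys_iff)

text \<open>The monomials of \<open>p\<close> divisible by the \<open>b j\<close>-th power of
  variable \<open>j\<close> are collected in \<open>S\<close>, and \<open>z\<close> is their sum
  after division. The same \<open>z\<close> inherits the grading of \<open>p\<close>, whatever
  \<open>V\<close> and \<open>E\<close> are.\<close>

lemma monomial_ideal_split:
  fixes p :: "'k::idom mpoly"
  assumes p: "p \<in> monomial_ideal (insert j D) b"
  obtains z where "p - monom_at j (b j) 1 * z \<in> monomial_ideal D b"
    "\<And>V E. p \<in> piece V E \<Longrightarrow> z \<in> piece V (E - int (b j))"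
proof -
  define S where "S = {m \<in> Poly_Mapping.keys p. b j \<le> Poly_Mapping.lookup m j}"
  \<comment> \<open>Monomials are subtracted with truncation; divisibility makes the subtraction
    exact.\<close>
  have S: "Poly_Mapping.single j (b j) + (m - Poly_Mapping.single j (b j)) = m" if "m \<in> S" for m
    using that by (intro poly_mapping_eqI) (auto simp: S_def lookup_add lookup_minus lookup_single when_def)
  have finS: "finite S" unfolding S_def by simp
  define z where "z = (\<Sum>m\<in>S. Poly_Mapping.single (m - Poly_Mapping.single j (b j)) (Poly_Mapping.lookup p m))"
  have z: "monom_at j (b j) 1 * z = (\<Sum>m\<in>S. Poly_Mapping.single m (Poly_Mapping.lookup p m))"
    unfolding z_def sum_distrib_left by (rule sum.cong) (auto simp: mult_single S)
  have lz: "Poly_Mapping.lookup (monom_at j (b j) 1 * z) m = (if m \<in> S then Poly_Mapping.lookup p m else 0)" for m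
    unfolding z lookup_sum lookup_single using finS by (simp add: when_def)
  show thesis
  proof
    show "p - monom_at j (b j) 1 * z \<in> monomial_ideal D b"
      using p unfolding monomial_ideal_def
      by (auto simp: in_keys_iff lookup_minus lz S_def split: if_splits)
    fix V E assume pV: "p \<in> piece V E"
    show "z \<in> piece V (E - int (b j))"
      unfolding piece_def
    proof (intro CollectI ballI)
      fix m assume "m \<in> Poly_Mapping.keys z"
      then have "Poly_Mapping.single j (b j) + m \<in> Poly_Mapping.keys (monom_at j (b j) 1 * z)"
        by (simp add: keys_single_mult)
      then have "Poly_Mapping.single j (b j) + m \<in> Poly_Mapping.keys p"
        by (auto simp: in_keys_iff lz split: if_splits)
      then have "Poly_Mapping.keys (Poly_Mapping.single j (b j) + m) \<subseteq> V"
         "int (monomial_degree (Poly_Mapping.single j (b j) + m)) = E"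
        using pV unfolding piece_def by blast+
      then show "Poly_Mapping.keys m \<subseteq> V \<and> int (monomial_degree m) = E - int (b j)"
        by (auto simp: keys_add_nat)
    qed
  qed
qed

lemma monomial_ideal_insert_iff_cong:
  fixes p :: "'k::idom mpoly"
  assumes "p - q \<in> monomial_ideal D b"
  shows "p \<in> monomial_ideal D b \<longleftrightarrow> q \<in> monomial_ideal D b"
  using assms monomial_ideal_add[of "p - q" D b q] monomial_ideal_diff[of p D b "p - q"] by auto

section \<open>The kernel of a linear form\<close>

lemma monomial_ideal_mult_right: "p \<in> monomial_ideal D b \<Longrightarrow> p * q \<in> monomial_ideal D b"
  using monomial_ideal_mult[of p D b q] by (simp add: mult.commute)

section \<open>Powers of linear forms in characteristic two\<close>

lemma mpoly_two_eq_zero: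
  assumes "(2::'k::comm_ring_1) = 0" shows "(2 :: 'k mpoly) = 0"
proof -
  have "(2 :: 'k mpoly) = Poly_Mapping.single 0 2" by (rule single_numeral[symmetric])
  then show ?thesis using assms by simp
qed

lemma sum_power_two_power:
  fixes f :: "'b \<Rightarrow> 'a::comm_ring_1"
  assumes "(2::'a) = 0"
  shows "sum f S ^ (2 ^ e) = (\<Sum>i\<in>S. f i ^ (2 ^ e))"
proof -
  have add: "(x + y)^2 = x^2 + y^2" for x y :: 'a
    using assms by (simp add: power2_sum)
  have sq: "(sum g S)^2 = (\<Sum>i\<in>S. (g i)^2)" for g :: "'b \<Rightarrow> 'a"
    by (induction S rule: infinite_finite_induct) (simp_all add: add)
  show ?thesis
    by (induction e) (simp_all add: power_mult power_mult[of _ "2^_" 2] sq mult.commute[of 2])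
qed

lemma monom_at_power: "monom_at i s u ^ t = monom_at i (t * s) (u ^ t)"
  by (induction t) (simp_all add: mult_single single_add)

lemma linear_form_power:
  assumes "(2::'k::comm_ring_1) = 0"
  shows "linear_form V (c :: nat \<Rightarrow> 'k) ^ (2 ^ e) = (\<Sum>i\<in>V. monom_at i (2 ^ e) (c i ^ (2 ^ e)))"
  unfolding linear_form_def sum_power_two_power[OF mpoly_two_eq_zero[OF assms]]
  by (simp add: monom_at_power)

text \<open>For positive \<open>b\<close>, the sum is the socle degree of the quotient by the powers
  \<open>b\<close>. The kernel is expressed on representatives, so that the argument can pass
  through the ideals for subsets of \<open>V\<close>. The subtraction of 1 is in the integers, so
  the bound keeps its meaning if a flip makes some \<open>b i\<close> zero.\<close>

definition injective_below_middle :: "nat set \<Rightarrow> (nat \<Rightarrow> 'k::comm_ring_1) \<Rightarrow> (nat \<Rightarrow> nat) \<Rightarrow> bool" where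
  "injective_below_middle V c b \<longleftrightarrow>
    (\<forall>D x. 2 * D < (\<Sum>i\<in>V. int (b i) - 1) \<longrightarrow> x \<in> piece V D \<longrightarrow>
      linear_form V c * x \<in> monomial_ideal V b \<longrightarrow> x \<in> monomial_ideal V b)"

text \<open>In degree \<open>D + 1 < b i\<close> the power of variable \<open>i\<close> divides no
  monomial, so \<open>linear_form V c * x\<close> vanishes already modulo the powers of the other
  variables. Modulo these, a high Frobenius power of the form is a unit times a power of variable
  \<open>i\<close>, which can be cancelled.\<close>

lemma injective_below_middle_dominant:
  fixes c :: "nat \<Rightarrow> 'k::field"
  assumes two: "(2::'k) = 0" and fin: "finite V" and i: "i \<in> V" "c i \<noteq> 0"
    and N: "(\<Sum>i\<in>V. int (b i) - 1) \<le> 2 * int (b i) - 2"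
  shows "injective_below_middle V c b"
  unfolding injective_below_middle_def
proof (intro allI impI)
  fix D :: int and x :: "'k mpoly"
  assume D: "2 * D < (\<Sum>i\<in>V. int (b i) - 1)" and x: "x \<in> piece V D"
    and lx: "linear_form V c * x \<in> monomial_ideal V b"
  have "linear_form V c * x \<in> piece V (D + 1)"
    by (rule piece_mult'[OF piece_linear_form x]) simp
  then have lx': "linear_form V c * x \<in> monomial_ideal (V - {i}) b"
    using lx D N unfolding monomial_ideal_def piece_def
  proof (intro CollectI ballI, goal_cases)
    case (1 m)
    then obtain h where h: "h \<in> V" "b h \<le> Poly_Mapping.lookup m h" by blast
    have "int (monomial_degree m) = D + 1" using 1 by blast
    then have "Poly_Mapping.lookup m i < b i"
      using lookup_le_monomial_degree[of m i] D N by linarith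
    then show ?case using h by (intro bexI[of _ h]) auto
  qed
  define e where "e = sum b V"
  have be: "b h \<le> 2 ^ e" if "h \<in> V" for h
  proof -
    have "b h \<le> e" unfolding e_def by (rule member_le_sum) (use fin that in auto)
    also have "e \<le> 2 ^ e" by (rule less_imp_le[OF less_exp])
    finally show ?thesis .
  qed
  let ?M = "monom_at i (2 ^ e) (c i ^ (2 ^ e))"
  have "linear_form V c ^ (2 ^ e) * x \<in> monomial_ideal (V - {i}) b"
    using monomial_ideal_mult[OF lx', of "linear_form V c ^ (2 ^ e - 1)"]
    using power_minus_mult[of "2 ^ e" "linear_form V c"] by (simp add: mult.assoc[symmetric])
  moreover have "linear_form V c ^ (2 ^ e) =
      ?M + (\<Sum>h\<in>V - {i}. monom_at h (2 ^ e) (c h ^ (2 ^ e)))"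
    unfolding linear_form_power[OF two] by (rule sum.remove[OF fin i(1)])
  moreover have "(\<Sum>h\<in>V - {i}. monom_at h (2 ^ e) (c h ^ (2 ^ e))) \<in> monomial_ideal (V - {i}) b"
    by (intro monomial_ideal_sum monom_at_in_monomial_ideal) (use be in auto)
  ultimately have "?M * x \<in> monomial_ideal (V - {i}) b"
    using monomial_ideal_diff[OF _ monomial_ideal_mult_right[of
        "\<Sum>h\<in>V - {i}. monom_at h (2 ^ e) (c h ^ (2 ^ e))" "V - {i}" b x], of "linear_form V c ^ (2 ^ e) * x"]
    by (simp add: distrib_right)
  then have "x \<in> monomial_ideal (V - {i}) b"
    by (rule monomial_ideal_cancel[rotated 2]) (use i in auto)
  then show "x \<in> monomial_ideal V b"
    by (rule monomial_ideal_mono[rotated]) auto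
qed

text \<open>By Frobenius, multiplying T_i^s by the form \<open>2 ^ e\<close> times gives a
  combination of the products T_i^s T_h^(2^e), and the bounds on \<open>b\<close> put each of them
  into the ideal. T_i^s itself is outside, so the chain enters the ideal at some step, and
  \<open>N\<close> bounds the degree of the last element before it.\<close>

lemma not_injective_below_middle:
  fixes c :: "nat \<Rightarrow> 'k::field"
  assumes two: "(2::'k) = 0" and fin: "finite V" and i: "i \<in> V" "s < b i" "b i \<le> 2 ^ e + s"
    and b: "\<And>h. h \<in> V \<Longrightarrow> h \<noteq> i \<Longrightarrow> b h \<le> 2 ^ e" "\<And>h. h \<in> V \<Longrightarrow> 1 \<le> b h"
    and N: "2 * (int s + 2 ^ e - 1) < (\<Sum>i\<in>V. int (b i) - 1)"
  shows "\<not> injective_below_middle V c b"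
proof
  assume inj: "injective_below_middle V c b"
  define x where "x j = monom_at i s 1 * linear_form V c ^ j" for j
  have "x (2 ^ e) = (\<Sum>h\<in>V. monom_at i s 1 * monom_at h (2 ^ e) (c h ^ (2 ^ e)))"
    unfolding x_def linear_form_power[OF two] sum_distrib_left ..
  also have "\<dots> \<in> monomial_ideal V b"
  proof (rule monomial_ideal_sum)
    fix h assume h: "h \<in> V"
    show "monom_at i s 1 * monom_at h (2 ^ e) (c h ^ (2 ^ e)) \<in> monomial_ideal V b"
    proof (cases "h = i")
      case True
      then show ?thesis using i
        by (simp add: mult_single single_add[symmetric] monom_at_in_monomial_ideal)
    next
      case False
      then show ?thesis
        using b(1) h by (intro monomial_ideal_mult monom_at_in_monomial_ideal)
    qed
  qed
  finally have "x (2 ^ e) \<in> monomial_ideal V b" .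
  moreover have "x 0 \<notin> monomial_ideal V b"
  proof
    assume "x 0 \<in> monomial_ideal V b"
    then obtain h where "h \<in> V" "b h \<le> Poly_Mapping.lookup (Poly_Mapping.single i s) h"
      unfolding x_def monomial_ideal_def by auto
    then show False using i b(2)[of h] by (auto simp: lookup_single when_def split: if_splits)
  qed
  ultimately obtain j where j: "j < 2 ^ e" "x j \<notin> monomial_ideal V b" "x (Suc j) \<in> monomial_ideal V b"
    using ex_least_nat_less[of "\<lambda>j. x j \<in> monomial_ideal V b" "2 ^ e"] by auto
  have "x j \<in> piece V (int s + int j)"
    unfolding x_def using i by (intro piece_mult piece_monom_at piece_linear_form_power) auto
  moreover have "2 * (int s + int j) < (\<Sum>i\<in>V. int (b i) - 1)"
  proof -
    have "int j + 1 \<le> 2 ^ e" using j(1)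
      by (metis Suc_eq_plus1 Suc_leI of_nat_1 of_nat_add of_nat_le_iff of_nat_numeral of_nat_power)
    then have "2 * (int s + int j) \<le> 2 * (int s + 2 ^ e - 1)" by simp
    then show ?thesis using N by (rule le_less_trans)
  qed
  moreover have "linear_form V c * x j = x (Suc j)"
    unfolding x_def by (simp add: algebra_simps)
  ultimately show False
    using inj j unfolding injective_below_middle_def by metis
qed

lemma monomial_ideal_split_piece:
  fixes p :: "'k::idom mpoly"
  assumes "p \<in> monomial_ideal (insert j D) b" "p \<in> piece V E"
  obtains z where "p - monom_at j (b j) 1 * z \<in> monomial_ideal D b" "z \<in> piece V (E - int (b j))"
proof (rule monomial_ideal_split[OF assms(1)])
  fix z assume "p - monom_at j (b j) 1 * z \<in> monomial_ideal D b"
    and "\<And>V E. p \<in> piece V E \<Longrightarrow> z \<in> piece V (E - int (b j))"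
  then show thesis using that assms(2) by blast
qed

text \<open>The coefficient \<open>u\<close> is built in because the complementary powers in the
  flip carry Frobenius powers of the coefficients of the linear form.\<close>

lemma monomial_ideal_split_unit:
  fixes p :: "'k::field mpoly"
  assumes "p \<in> monomial_ideal (insert j D) b" "u \<noteq> 0"
  obtains z where "p - monom_at j (b j) u * z \<in> monomial_ideal D b"
proof (rule monomial_ideal_split[OF assms(1)])
  fix z assume "p - monom_at j (b j) 1 * z \<in> monomial_ideal D b"
  moreover have "monom_at j (b j) 1 * z = monom_at j (b j) u * (Poly_Mapping.single 0 (inverse u) * z)"
    using assms(2) by (simp add: mult.assoc[symmetric] mult_single)
  ultimately show thesis using that by simp
qed

text \<open>
  Multiplication by \<open>l\<close> and by \<open>l\<^sup>2\<^sup>q\<^sup>-\<^sup>1\<close>, with \<open>l\<^sup>2\<^sup>q = T\<^sub>i\<^sup>2\<^sup>q + T\<^sub>j\<^sup>2\<^sup>q\<close> modulo the other powers, form a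
  matrix factorisation that exchanges the kernel for the exponents \<open>b\<^sub>i, b\<^sub>j\<close> with the kernel for
  \<open>2q - b\<^sub>i, 2q - b\<^sub>j\<close>, up to the image of \<open>l\<^sup>2\<^sup>q\<^sup>-\<^sup>1\<close>, which lives in degrees beyond the middle.
\<close>

lemma injective_below_middle_flip:
  fixes c :: "nat \<Rightarrow> 'k::field"
  assumes two: "(2::'k) = 0" and fin: "finite V" and ij: "i \<in> V" "j \<in> V" "i \<noteq> j"
    and c: "c i \<noteq> 0" "c j \<noteq> 0"
    and b: "\<And>h. h \<in> V \<Longrightarrow> b h \<le> 2 ^ Suc e"
    and N: "(\<Sum>h\<in>V. int (b h) - 1) \<le> 2 * 2 ^ Suc e - 2"
    and inj: "injective_below_middle V c (b(i := 2 ^ Suc e - b i, j := 2 ^ Suc e - b j))"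
  shows "injective_below_middle V c b"
  unfolding injective_below_middle_def
proof (intro allI impI)
  fix G :: int and x :: "'k mpoly"
  assume G: "2 * G < (\<Sum>h\<in>V. int (b h) - 1)" and x: "x \<in> piece V G"
    and lx: "linear_form V c * x \<in> monomial_ideal V b"
  define r where "r = (2::nat) ^ Suc e"
  have r: "r \<ge> 1" "b i \<le> r" "b j \<le> r" using b ij unfolding r_def by auto
  define b' where "b' = b(i := r - b i, j := r - b j)"
  have bi: "b' i = r - b i" "b' j = r - b j" using ij unfolding b'_def by auto
  define D where "D = V - {i, j}"
  \<comment> \<open>\<open>I\<close> leaves out the powers of the variables \<open>i\<close> and
    \<open>j\<close>. Modulo \<open>I\<close> either variable can be cancelled, even after adding a
    power of the other; every division below rests on this.\<close>
  define I :: "'k mpoly set" where "I = monomial_ideal D b"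
  have V: "V = insert i (insert j D)" using ij unfolding D_def by auto
  have D: "i \<notin> D" "j \<notin> D" "i \<notin> insert j D" "j \<notin> insert i D" using ij unfolding D_def by auto
  have I': "I = monomial_ideal D b'"
    unfolding I_def b'_def using D by (intro monomial_ideal_cong) auto
  define l where "l = linear_form V c"
  define L where "L = l ^ (r - 1)"
  define P where "P = monom_at i (b i) (1::'k)"
  define Q where "Q = monom_at j (b j) (1::'k)"
  \<comment> \<open>\<open>P'\<close> and \<open>Q'\<close> complete \<open>P\<close> and
    \<open>Q\<close> to the two summands of \<open>l ^ r\<close> that survive modulo
    \<open>I\<close>, Frobenius coefficients included.\<close>
  define P' where "P' = monom_at i (r - b i) (c i ^ r)"
  define Q' where "Q' = monom_at j (r - b j) (c j ^ r)"
  have I_add: "p + q \<in> I" and I_diff: "p - q \<in> I" if "p \<in> I" "q \<in> I" for p q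
    using that unfolding I_def by (auto intro: monomial_ideal_add monomial_ideal_diff)
  have I_mult: "q * p \<in> I" and I_mult_right: "p * q \<in> I" if "p \<in> I" for p q
    using that unfolding I_def by (auto intro: monomial_ideal_mult monomial_ideal_mult_right)
  have subb: "p \<in> monomial_ideal E b" if "p \<in> I" "D \<subseteq> E" for p E
    using that monomial_ideal_mono[of D E p b] unfolding I_def by blast
  have subb': "p \<in> monomial_ideal E b'" if "p \<in> I" "D \<subseteq> E" for p E
    using that monomial_ideal_mono[of D E p b'] unfolding I' by blast
  have cancel: "p \<in> I" if "M * p \<in> I" "M = monom_at h s u" "h \<notin> D" "u \<noteq> 0" for M p h s u
    using monomial_ideal_cancel[of u h D s p b] that unfolding I_def by blast

  have factor: "l * L - P * P' - Q * Q' \<in> I"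
  proof -
    have "l * L = l ^ r" unfolding L_def using r by (simp add: power_eq_if)
    also have "\<dots> = (\<Sum>h\<in>V. monom_at h r (c h ^ r))"
      unfolding l_def r_def by (rule linear_form_power[OF two])
    also have "\<dots> = monom_at i r (c i ^ r) + (monom_at j r (c j ^ r) + (\<Sum>h\<in>D. monom_at h r (c h ^ r)))"
      using fin D unfolding V by (simp del: insert_iff)
    also have "monom_at i r (c i ^ r) = P * P'"
      unfolding P_def P'_def using r by (simp add: mult_single single_add[symmetric])
    also have "monom_at j r (c j ^ r) = Q * Q'"
      unfolding Q_def Q'_def using r by (simp add: mult_single single_add[symmetric])
    finally have "l * L - P * P' - Q * Q' = (\<Sum>h\<in>D. monom_at h r (c h ^ r))" by simp
    also have "\<dots> \<in> I"
      unfolding I_def by (intro monomial_ideal_sum monom_at_in_monomial_ideal)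
        (use b in \<open>auto simp: D_def r_def\<close>)
    finally show ?thesis .
  qed

  have lxV: "l * x \<in> piece V (G + 1)"
    unfolding l_def by (rule piece_mult'[OF piece_linear_form x]) simp
  have "l * x \<in> monomial_ideal (insert i (insert j D)) b"
    using lx unfolding l_def V .
  then obtain y where y: "l * x - P * y \<in> monomial_ideal (insert j D) b" "y \<in> piece V (G + 1 - int (b i))"
    unfolding P_def by (rule monomial_ideal_split_piece[OF _ lxV])
  obtain w where w: "l * x - P * y - Q * w \<in> I"
    unfolding I_def Q_def by (rule monomial_ideal_split[OF y(1)])

  \<comment> \<open>\<open>x\<close> with its cofactors \<open>y\<close> and \<open>w\<close> is a
    syzygy. Multiplying it by \<open>L\<close> and using the factorisation leaves a relation between
    \<open>P\<close> and \<open>Q\<close> with coefficients \<open>p\<close> and \<open>s\<close>.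
    Hence \<open>p\<close> is a multiple \<open>Q * z\<close>, and this \<open>z\<close> is the
    partner of \<open>x\<close> for the exchanged exponents.\<close>
  define p where "p = L * y - P' * x"
  define s where "s = L * w - Q' * x"
  have ps: "P * p + Q * s \<in> I"
  proof -
    have "P * p + Q * s = (l * L - P * P' - Q * Q') * x - L * (l * x - P * y - Q * w)"
      unfolding p_def s_def by (simp add: algebra_simps)
    then show ?thesis using I_diff[OF I_mult_right[OF factor] I_mult[OF w]] by simp
  qed
  have "Q \<in> monomial_ideal (insert j D) b"
    unfolding Q_def by (rule monom_at_in_monomial_ideal) auto
  then have "P * p + Q * s - Q * s \<in> monomial_ideal (insert j D) b"
    by (intro monomial_ideal_diff monomial_ideal_mult_right subb[OF ps] subset_insertI)
  then have "P * p \<in> monomial_ideal (insert j D) b" by (simp only: add_diff_cancel_right')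
  then have "p \<in> monomial_ideal (insert j D) b"
    unfolding P_def by (rule monomial_ideal_cancel[rotated 2]) (use D in auto)
  moreover have "p \<in> piece V (G + int r - int (b i))"
  proof -
    have "L * y \<in> piece V (G + int r - int (b i))"
      unfolding L_def l_def by (rule piece_mult'[OF piece_linear_form_power y(2)]) (use r in simp)
    moreover have "P' \<in> piece V (int r - int (b i))"
      unfolding P'_def using r ij by (intro piece_monom_at) auto
    then have "P' * x \<in> piece V (G + int r - int (b i))"
      by (rule piece_mult'[OF _ x]) simp
    ultimately show ?thesis unfolding p_def by (rule piece_diff)
  qed
  ultimately obtain z where z: "p - Q * z \<in> I" "z \<in> piece V (G + int r - int (b i) - int (b j))"
    unfolding I_def Q_def by (rule monomial_ideal_split_piece)

  \<comment> \<open>Verified after multiplication by \<open>Q\<close>, which can be cancelled. Since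
    \<open>P'\<close> and \<open>Q'\<close> are powers from \<open>b'\<close>, it puts
    \<open>z\<close> into the kernel for the exchanged exponents.\<close>
  have lz: "l * z - (Q' * y - P' * w) \<in> I"
  proof -
    have "Q * (l * z - (Q' * y - P' * w)) = (l * L - P * P' - Q * Q') * y
        - P' * (l * x - P * y - Q * w) - l * (p - Q * z)"
      unfolding p_def by (simp add: algebra_simps)
    also have "\<dots> \<in> I"
      by (intro I_diff I_mult_right[OF factor] I_mult[OF w] I_mult[OF z(1)])
    finally show ?thesis
      by (rule cancel[OF _ Q_def]) (use D in auto)
  qed
  have P'_in: "P' \<in> monomial_ideal (insert i E) b'" for E
    unfolding P'_def b'_def using ij by (intro monom_at_in_monomial_ideal) auto
  have Q'_in: "Q' \<in> monomial_ideal (insert j E) b'" for E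
    unfolding Q'_def b'_def using ij by (intro monom_at_in_monomial_ideal) auto
  have "Q' * y - P' * w \<in> monomial_ideal V b'"
    using P'_in[of "insert j D"] Q'_in[of "insert i D"] unfolding V insert_commute[of j i]
    by (intro monomial_ideal_diff monomial_ideal_mult_right)
  with subb'[OF lz, of V] have "l * z \<in> monomial_ideal V b'"
    using monomial_ideal_insert_iff_cong[of "l * z"] V by blast
  \<comment> \<open>The degree changes by \<open>r - b i - b j\<close> and the socle degree by twice
    as much, so \<open>z\<close> is as far below the new middle as \<open>x\<close> is below the old
    one.\<close>
  moreover have "2 * (G + int r - int (b i) - int (b j)) < (\<Sum>h\<in>V. int (b' h) - 1)"
  proof -
    have "(\<Sum>h\<in>D. int (b' h) - 1) = (\<Sum>h\<in>D. int (b h) - 1)"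
      unfolding b'_def using D by (intro sum.cong) auto
    then show ?thesis
      using G fin D ij r unfolding V by (simp add: b'_def of_nat_diff)
  qed
  ultimately have "z \<in> monomial_ideal V b'"
    using inj z(2) unfolding injective_below_middle_def l_def b'_def r_def by blast
  then have "z \<in> monomial_ideal (insert i (insert j D)) b'" unfolding V .
  then obtain u where u: "z - P' * u \<in> monomial_ideal (insert j D) b'"
    using monomial_ideal_split_unit[of z i "insert j D" b' "c i ^ r", unfolded bi, folded P'_def] c
    by auto
  obtain v where v: "z - P' * u - Q' * v \<in> I"
    using monomial_ideal_split_unit[OF u, of "c j ^ r", unfolded bi, folded Q'_def I'] c by auto

  \<comment> \<open>Two expressions for \<open>l * z\<close>, one through \<open>y\<close> and
    \<open>w\<close>, the other through \<open>u\<close> and \<open>v\<close>, differ by a relation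
    between \<open>P'\<close> and \<open>Q'\<close>. It forces \<open>y - l * v\<close> to be a
    multiple \<open>P' * g\<close> modulo \<open>I\<close>.\<close>
  have yv: "Q' * (y - l * v) - P' * (w + l * u) \<in> I"
  proof -
    have "Q' * (y - l * v) - P' * (w + l * u) = l * (z - P' * u - Q' * v) - (l * z - (Q' * y - P' * w))"
      by (simp add: algebra_simps)
    then show ?thesis using I_diff[OF I_mult[OF v] lz] by simp
  qed
  have "Q' * (y - l * v) - P' * (w + l * u) + P' * (w + l * u) \<in> monomial_ideal (insert i D) b'"
    by (intro monomial_ideal_add monomial_ideal_mult_right subb'[OF yv] subset_insertI P'_in)
  then have "Q' * (y - l * v) \<in> monomial_ideal (insert i D) b'" by (simp only: diff_add_cancel)
  then have "y - l * v \<in> monomial_ideal (insert i D) b'"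
    unfolding Q'_def by (rule monomial_ideal_cancel[rotated 2]) (use D c in auto)
  then obtain g where g: "y - l * v - P' * g \<in> I"
    using monomial_ideal_split_unit[of _ i D b' "c i ^ r", unfolded bi, folded P'_def I'] c by auto

  \<comment> \<open>Substituting into \<open>p\<close> and cancelling \<open>P'\<close> recovers
    \<open>x\<close> as \<open>L * g\<close> up to multiples of \<open>P\<close> and
    \<open>Q\<close>.\<close>
  have "P' * (L * g - x - Q * u + P * v) = (p - Q * z) - L * (y - l * v - P' * g)
      + Q * (z - P' * u - Q' * v) - (l * L - P * P' - Q * Q') * v"
    unfolding p_def by (simp add: algebra_simps)
  also have "\<dots> \<in> I"
    by (intro I_diff I_add I_mult_right[OF factor] I_mult[OF g] I_mult[OF v] z(1))
  finally have t: "L * g - x - Q * u + P * v \<in> I"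
    by (rule cancel[OF _ P'_def]) (use D c in auto)
  have "P \<in> monomial_ideal V b" "Q \<in> monomial_ideal V b"
    unfolding P_def Q_def using ij by (auto intro: monom_at_in_monomial_ideal)
  then have "P * v - Q * u - (L * g - x - Q * u + P * v) \<in> monomial_ideal V b"
    using subb[OF t, of V] V
    by (intro monomial_ideal_diff monomial_ideal_mult_right) auto
  then have xLg: "x - L * g \<in> monomial_ideal V b" by simp
  \<comment> \<open>The degree of \<open>g\<close> is not controlled, so coefficients are compared:
    every monomial of \<open>L * g\<close> has degree at least \<open>r - 1\<close>, whereas
    \<open>N\<close> gives \<open>G < r - 1\<close>.\<close>
  have "\<exists>h\<in>V. b h \<le> Poly_Mapping.lookup m h" if m: "m \<in> Poly_Mapping.keys x" for m
  proof -
    have mG: "int (monomial_degree m) = G" using m x unfolding piece_def by blast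
    have "m \<notin> Poly_Mapping.keys (L * g)"
    proof
      assume "m \<in> Poly_Mapping.keys (L * g)"
      then obtain m1 m2 where m12: "m = m1 + m2" "m1 \<in> Poly_Mapping.keys L"
        using keys_mult[of L g] by blast
      have "L \<in> piece V (int (r - 1))" unfolding L_def l_def by (rule piece_linear_form_power)
      then have "int (monomial_degree m1) = int (r - 1)" using m12 unfolding piece_def by blast
      then have "int r - 1 \<le> int (monomial_degree m)" using m12 r by simp
      then show False using mG G N r unfolding r_def by simp
    qed
    then have "m \<in> Poly_Mapping.keys (x - L * g)" using m by (simp add: in_keys_iff lookup_minus)
    then show ?thesis using xLg unfolding monomial_ideal_def by blast
  qed
  then show "x \<in> monomial_ideal V b" unfolding monomial_ideal_def by simp
qed

section \<open>The digit condition\<close>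

text \<open>This says that a Nim-sum is below \<open>2 ^ m\<close>. It is written with digit
  parities so that complementing a digit in two entries visibly changes nothing.\<close>

definition nim_below :: "nat set \<Rightarrow> nat \<Rightarrow> (nat \<Rightarrow> nat) \<Rightarrow> bool" where
  "nim_below V m a \<longleftrightarrow> (\<forall>p\<ge>m. even (\<Sum>i\<in>V. of_bool (bit (a i) p) :: nat))"

text \<open>A finite variant of \<open>\<theta>\<^sub>q\<close>: its value is \<open>-1\<close> where \<open>\<theta>\<^sub>q\<close> is \<open>-\<infinity>\<close>.\<close>

definition tau :: "nat \<Rightarrow> nat \<Rightarrow> int" where
  "tau q x = min (int (x mod (2 * q))) (2 * int q - 2 - int (x mod (2 * q)))"

text \<open>An entry whose residue consists of ones only has \<theta> = -\<infinity> and makes the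
  whole sum -\<infinity>. The first disjunct stands for this and keeps the sums in the
  integers.\<close>

definition nim_condition :: "nat set \<Rightarrow> (nat \<Rightarrow> nat) \<Rightarrow> bool" where
  "nim_condition V a \<longleftrightarrow> (\<forall>k\<ge>1. nim_below V (Suc k) a \<longrightarrow>
    (\<exists>i\<in>V. a i mod 2 ^ Suc k = 2 ^ Suc k - 1) \<or> (\<Sum>i\<in>V. tau (2 ^ k) (a i)) \<le> 2 * 2 ^ k - 2)"

section \<open>Binary digits and \<open>tau\<close> under reflection\<close>

lemma tau_le: "tau q x \<le> int x"
  unfolding tau_def by (metis min.coboundedI1 mod_less_eq_dividend of_nat_le_iff)

lemma tau_small: "x < q \<Longrightarrow> tau q x = int x"
  unfolding tau_def by auto

lemma tau_large: "q \<le> x \<Longrightarrow> x < 2 * q \<Longrightarrow> tau q x = 2 * int q - 2 - int x"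
  unfolding tau_def by auto

lemma not_bit_ge: "x < 2 ^ m \<Longrightarrow> m \<le> p \<Longrightarrow> \<not> bit (x::nat) p"
  unfolding bit_iff_odd
  by (metis div_less even_zero less_le_trans one_le_numeral power_increasing)

lemma bit_top: "x < 2 ^ Suc e \<Longrightarrow> bit (x::nat) e \<longleftrightarrow> 2 ^ e \<le> x"
proof -
  assume x: "x < 2 ^ Suc e"
  then have "x div 2 ^ e < 2" by (simp add: less_mult_imp_div_less)
  moreover have "2 ^ e \<le> x \<longleftrightarrow> 1 \<le> x div 2 ^ e" by (simp add: Suc_le_eq div_greater_zero_iff)
  ultimately show ?thesis unfolding bit_iff_odd
    by (metis One_nat_def even_zero less_2_cases less_one not_less odd_one)
qed

lemma bit_complement:
  assumes "u < 2 ^ k" "j < k"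
  shows "bit (2 ^ k - 1 - u :: nat) j \<longleftrightarrow> \<not> bit u j"
proof -
  have "int (2 ^ k - 1 - u) = mask k - take_bit k (int u)"
    using assms(1) by (simp add: mask_eq_exp_minus_1 take_bit_int_eq_self of_nat_diff)
  also have "\<dots> = take_bit k (not (int u))" by (rule take_bit_not_eq_mask_diff[symmetric])
  finally have "bit (int (2 ^ k - 1 - u)) j = bit (take_bit k (not (int u))) j" by simp
  then show ?thesis using assms(2) by (simp add: bit_take_bit_iff bit_not_iff bit_of_nat_iff_bit)
qed

text \<open>With a = u 2^m + r the reflected number is (K - 1 - u) 2^m + (2^m - 2 - r). There is no
  borrow from the upper part precisely because r is not 2^m - 1.\<close>

lemma reflect_split:
  assumes a: "a < 2 ^ m * K" and r: "a mod 2 ^ m \<noteq> 2 ^ m - (1::nat)" and "1 \<le> m"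
  shows "(2 ^ m * K - 2 - a) div 2 ^ m = K - 1 - a div 2 ^ m"
    "(2 ^ m * K - 2 - a) mod 2 ^ m = 2 ^ m - 2 - a mod 2 ^ m"
proof -
  let ?M = "2 ^ m :: nat" 
  have M: "2 \<le> ?M" using assms(3) by (metis one_le_numeral power_increasing power_one_right)
  have r': "a mod ?M + 2 \<le> ?M" using r M
    by (metis Suc_leI Suc_lessI add_2_eq_Suc' diff_Suc_1 mod_less_divisor pos2 zero_less_power)
  have u: "a div ?M + 1 \<le> K" using a by (simp add: Suc_le_eq less_mult_imp_div_less mult.commute)
  then obtain K' where K': "K = a div ?M + 1 + K'" using le_Suc_ex by blast
  have "?M * K = ?M * (a div ?M) + ?M + ?M * K'" unfolding K' by (simp add: algebra_simps)
  moreover have "a = ?M * (a div ?M) + a mod ?M" by simp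
  ultimately have "?M * K - 2 - a = ?M * K' + (?M - 2 - a mod ?M)" using r' by linarith
  moreover have "?M - 2 - a mod ?M < ?M" using M by linarith
  ultimately show "(?M * K - 2 - a) div ?M = K - 1 - a div ?M" "(?M * K - 2 - a) mod ?M = ?M - 2 - a mod ?M"
    using K' by simp_all
qed

text \<open>One direction follows from the splitting; the other from it as well, since reflecting
  twice returns \<open>a\<close>.\<close>

lemma reflect_mod_max_iff:
  assumes a: "a + 2 \<le> 2 ^ m * K" and "1 \<le> m"
  shows "(2 ^ m * K - 2 - a) mod 2 ^ m = 2 ^ m - (1::nat) \<longleftrightarrow> a mod 2 ^ m = 2 ^ m - 1"
proof -
  let ?M = "2 ^ m :: nat"
  have M: "2 \<le> ?M" using assms(2) by (metis one_le_numeral power_increasing power_one_right)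
  have one: "(2 ^ m * K - 2 - x) mod ?M \<noteq> ?M - 1" if "x + 2 \<le> ?M * K" "x mod ?M \<noteq> ?M - 1" for x
    using reflect_split(2)[of x m K] that M assms(2) by linarith
  have "2 ^ m * K - 2 - (2 ^ m * K - 2 - a) = a" "2 ^ m * K - 2 - a + 2 \<le> 2 ^ m * K" using a by auto
  then show ?thesis
    using one[of a] one[of "2 ^ m * K - 2 - a"] a by metis
qed

text \<open>Because \<open>2 * 2 ^ e\<close> is a multiple of \<open>2 ^ Suc k\<close>, the residue
  is itself reflected, which swaps the two arguments of \<open>min\<close>.\<close>

lemma tau_reflect:
  assumes "a + 2 \<le> 2 * 2 ^ e" "k \<le> e" "a mod 2 ^ Suc k \<noteq> 2 ^ Suc k - 1"
  shows "tau (2 ^ k) (2 * 2 ^ e - 2 - a) = tau (2 ^ k) a"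
proof -
  have *: "2 * 2 ^ e = 2 ^ Suc k * (2 ^ (e - k) :: nat)" using assms(2)
    by (simp add: power_add[symmetric])
  have "x + 2 \<le> M" if "x < M" "x \<noteq> M - 1" for x M :: nat
    using that by linarith
  from this[of "a mod 2 ^ Suc k" "2 ^ Suc k"] have lt: "a mod 2 ^ Suc k + 2 \<le> 2 * 2 ^ k"
    using assms(3) by simp
  have "(2 * 2 ^ e - 2 - a) mod 2 ^ Suc k = 2 ^ Suc k - 2 - a mod 2 ^ Suc k"
    unfolding * by (rule reflect_split) (use assms(1,3) * in auto)
  then show ?thesis unfolding tau_def using lt by (simp add: of_nat_diff min.commute)
qed

lemma bit_reflect:
  fixes a :: nat
  assumes "a + 2 \<le> 2 * 2 ^ e" "k \<le> e" "a mod 2 ^ Suc k \<noteq> 2 ^ Suc k - 1" "Suc k \<le> p" "p \<le> e"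
  shows "bit (2 * 2 ^ e - 2 - a) p \<longleftrightarrow> \<not> bit a p"
proof -
  have *: "2 * 2 ^ e = 2 ^ Suc k * (2 ^ (e - k) :: nat)" using assms(2)
    by (simp add: power_add[symmetric])
  have bd: "bit x p = bit (x div 2 ^ Suc k) (p - Suc k)" for x :: nat
    using assms(4) by (metis bit_drop_bit_eq comp_apply drop_bit_eq_div le_add_diff_inverse)
  have "(2 * 2 ^ e - 2 - a) div 2 ^ Suc k = 2 ^ (e - k) - 1 - a div 2 ^ Suc k"
    unfolding * by (rule reflect_split) (use assms(1,3) * in auto)
  moreover have "a div 2 ^ Suc k < 2 ^ (e - k)"
    using assms(1) * by (simp add: less_mult_imp_div_less mult.commute)
  ultimately show ?thesis unfolding bd using assms bit_complement[of "a div 2 ^ Suc k" "e - k" "p - Suc k"]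
    by simp
qed

text \<open>At each position from \<open>Suc k\<close> to \<open>e\<close> exactly two digits are
  complemented, which keeps the parity; beyond \<open>e\<close> all digits are zero before and
  after.\<close>

lemma nim_condition_reflect:
  assumes fin: "finite V" and ij: "i \<in> V" "j \<in> V" "i \<noteq> j"
    and a: "\<And>h. h \<in> V \<Longrightarrow> a h + 2 \<le> 2 * 2 ^ e"
    and a': "a' = a(i := 2 * 2 ^ e - 2 - a i, j := 2 * 2 ^ e - 2 - a j)"
    and k: "k \<le> e" "\<forall>h\<in>V. a h mod 2 ^ Suc k \<noteq> 2 ^ Suc k - 1"
  shows "nim_below V (Suc k) a' \<longleftrightarrow> nim_below V (Suc k) a"
    "(\<Sum>h\<in>V. tau (2 ^ k) (a' h)) = (\<Sum>h\<in>V. tau (2 ^ k) (a h))"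
proof -
  define D where "D = V - {i, j}"
  have V: "V = insert i (insert j D)" and D: "i \<notin> D" "j \<notin> D" "i \<notin> insert j D" "finite D"
    using ij fin unfolding D_def by auto
  have ai: "a i + 2 \<le> 2 * 2 ^ e" "a i mod 2 ^ Suc k \<noteq> 2 ^ Suc k - 1" "a' i = 2 * 2 ^ e - 2 - a i"
   and aj: "a j + 2 \<le> 2 * 2 ^ e" "a j mod 2 ^ Suc k \<noteq> 2 ^ Suc k - 1" "a' j = 2 * 2 ^ e - 2 - a j"
    using a k ij a' by auto
  have eqD: "(\<Sum>h\<in>D. f (a' h)) = (\<Sum>h\<in>D. f (a h))" for f :: "nat \<Rightarrow> 'x::comm_monoid_add"
    unfolding a' using D by (intro sum.cong) auto
  show "(\<Sum>h\<in>V. tau (2 ^ k) (a' h)) = (\<Sum>h\<in>V. tau (2 ^ k) (a h))"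
    unfolding V using D eqD[of "tau (2 ^ k)"] tau_reflect[OF ai(1) k(1) ai(2)] tau_reflect[OF aj(1) k(1) aj(2)] ai(3) aj(3)
    by (simp add: ij(3))
  have "even (\<Sum>h\<in>V. of_bool (bit (a' h) p) :: nat) \<longleftrightarrow> even (\<Sum>h\<in>V. of_bool (bit (a h) p) :: nat)"
    if "Suc k \<le> p" for p
  proof (cases "p \<le> e")
    case True
    have "bit (a' i) p \<longleftrightarrow> \<not> bit (a i) p" "bit (a' j) p \<longleftrightarrow> \<not> bit (a j) p"
      using bit_reflect[OF ai(1) k(1) ai(2) that True] bit_reflect[OF aj(1) k(1) aj(2) that True] ai(3) aj(3)
      by auto
    then show ?thesis
      unfolding V using D eqD[of "\<lambda>x. of_bool (bit x p) :: nat"] by (simp add: ij(3) del: sum_of_bool_eq)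
  next
    case False
    have "\<not> bit (a h) p" "\<not> bit (a' h) p" if "h \<in> V" for h
    proof -
      have "a h < 2 ^ Suc e" "a' h < 2 ^ Suc e" using a[OF that] ai aj unfolding a' by auto
      then show "\<not> bit (a h) p" "\<not> bit (a' h) p"
        using False not_bit_ge[of _ "Suc e" p] by auto
    qed
    then show ?thesis by simp
  qed
  then show "nim_below V (Suc k) a' \<longleftrightarrow> nim_below V (Suc k) a"
    unfolding nim_below_def by blast
qed

text \<open>Since \<open>tau\<close> never exceeds its argument, a bound on the total settles all
  \<open>k\<close> above \<open>e\<close> at once.\<close>

lemma nim_condition_below:
  assumes "(\<Sum>i\<in>V. int (a i)) \<le> 2 * 2 ^ Suc e - 2" "e < k"
  shows "(\<Sum>i\<in>V. tau (2 ^ k) (a i)) \<le> 2 * 2 ^ k - 2"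
proof -
  have "(\<Sum>i\<in>V. tau (2 ^ k) (a i)) \<le> (\<Sum>i\<in>V. int (a i))"
    by (intro sum_mono tau_le)
  also have "\<dots> \<le> 2 * 2 ^ Suc e - 2" by fact
  also have "(2::int) ^ Suc e \<le> 2 ^ k" using assms(2) by (intro power_increasing) auto
  finally show ?thesis by simp
qed

lemma nim_below_bound:
  assumes "\<And>i. i \<in> V \<Longrightarrow> a i < 2 ^ m"
  shows "nim_below V m a"
  unfolding nim_below_def using not_bit_ge[OF assms] by auto

text \<open>Every lower residue of 2^(e+1) - 1 again consists of ones, which covers
  \<open>k \<le> e\<close>; the bound on the total covers the rest.\<close>

lemma nim_condition_if_max:
  assumes i: "i \<in> V" "a i = 2 ^ Suc e - 1" and N: "(\<Sum>i\<in>V. int (a i)) \<le> 2 * 2 ^ Suc e - 2"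
  shows "nim_condition V a"
  unfolding nim_condition_def
proof (intro allI impI)
  fix k :: nat assume "1 \<le> k"
  show "(\<exists>i\<in>V. a i mod 2 ^ Suc k = 2 ^ Suc k - 1) \<or> (\<Sum>i\<in>V. tau (2 ^ k) (a i)) \<le> 2 * 2 ^ k - 2"
  proof (cases "k \<le> e")
    case True
    have "a i mod 2 ^ Suc k = 2 ^ Suc k - 1"
    proof -
      have "a i = mask (Suc e)" using i(2) by (simp add: mask_eq_exp_minus_1)
      then have "take_bit (Suc k) (a i) = mask (Suc k)" using True by (simp add: min_def)
      then show ?thesis by (simp add: take_bit_eq_mod mask_eq_exp_minus_1)
    qed
    then show ?thesis using i by blast
  next
    case False
    then show ?thesis using nim_condition_below[OF N, of k] by auto
  qed
qed

lemma sum_int_Suc: "(\<Sum>i\<in>V. int (Suc (a i)) - 1) = (\<Sum>i\<in>V. int (a i))"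
  by (rule sum.cong) auto

text \<open>Strong induction on a digit bound \<open>e\<close> and, for fixed \<open>e\<close>, on
  the sum of the exponents: a flip keeps the bound and lowers the sum, and the bound drops once all
  exponents are below \<open>2 ^ e\<close>. Both sides are transported through a flip, so the
  equivalence itself is the induction statement.\<close>

theorem injective_below_middle_iff_nim_condition:
  fixes c :: "nat \<Rightarrow> 'k::field"
  assumes two: "(2::'k) = 0" and fin: "finite V" and c: "\<And>i. i \<in> V \<Longrightarrow> c i \<noteq> 0"
  shows "injective_below_middle V c (\<lambda>i. Suc (a i)) \<longleftrightarrow> nim_condition V a"
proof -
  have main: "(\<forall>i\<in>V. a i < 2 ^ Suc e) \<longrightarrow>
      (injective_below_middle V c (\<lambda>i. Suc (a i)) \<longleftrightarrow> nim_condition V a)" for e a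
  proof (induction e arbitrary: a rule: less_induct)
    case (less e)
    note IHe = less.IH
    show ?case
    proof (induction "sum a V" arbitrary: a rule: less_induct)
      case (less a)
      note IHa = less.hyps
      let ?W = "\<lambda>a. injective_below_middle V c (\<lambda>i. Suc (a i))"
      define N where "N = (\<Sum>i\<in>V. int (a i))"
      note not_inj = not_injective_below_middle[OF two fin, of _ _ "\<lambda>i. Suc (a i)", unfolded sum_int_Suc, folded N_def]
      have dominant: "?W a" if "i \<in> V" "N \<le> 2 * int (a i)" for i
        using injective_below_middle_dominant[OF two fin that(1), of c "\<lambda>i. Suc (a i)"] c[OF that(1)] that(2)
        unfolding sum_int_Suc N_def by simp
      show ?case
      proof
        assume a: "\<forall>i\<in>V. a i < 2 ^ Suc e"
        \<comment> \<open>The flip applies in case \<open>two\<close>, and \<open>e\<close> drops in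
          case \<open>none\<close> unless it is 0; the other cases are decided directly. Setting
          apart \<open>2 ^ Suc e - 1\<close> makes the reflection of an exponent
          nonnegative.\<close>
        consider (large) "N > 2 * 2 ^ Suc e - 2"
          | (max) i where "N \<le> 2 * 2 ^ Suc e - 2" "i \<in> V" "a i = 2 ^ Suc e - 1"
          | (two) i j where "N \<le> 2 * 2 ^ Suc e - 2" "\<forall>h\<in>V. a h + 2 \<le> 2 ^ Suc e"
              "i \<in> V" "j \<in> V" "i \<noteq> j" "2 ^ e \<le> a i" "2 ^ e \<le> a j"
          | (one) i where "N \<le> 2 * 2 ^ Suc e - 2" "\<forall>h\<in>V. a h + 2 \<le> 2 ^ Suc e"
              "i \<in> V" "2 ^ e \<le> a i" "\<forall>h\<in>V - {i}. a h < 2 ^ e"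
          | (none) "N \<le> 2 * 2 ^ Suc e - 2" "\<forall>h\<in>V. a h < 2 ^ e"
        proof (cases "N \<le> 2 * 2 ^ Suc e - 2")
          case False
          then show thesis using large by linarith
        next
          case N: True
          show thesis
          proof (cases "\<exists>i\<in>V. a i = 2 ^ Suc e - 1")
            case True
            then show thesis using max N by blast
          next
            case False
            have le: "\<forall>h\<in>V. a h + 2 \<le> 2 ^ Suc e"
            proof
              fix h assume "h \<in> V"
              then have "a h < 2 ^ Suc e" "a h \<noteq> 2 ^ Suc e - 1" using a False by blast+
              then show "a h + 2 \<le> 2 ^ Suc e" by linarith
            qed
            show thesis
            proof (cases "\<exists>i\<in>V. 2 ^ e \<le> a i")
              case True
              then obtain i where i: "i \<in> V" "2 ^ e \<le> a i" by blast
              show thesis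
              proof (cases "\<exists>j\<in>V. j \<noteq> i \<and> 2 ^ e \<le> a j")
                case True
                then show thesis using two[OF N le i(1) _ _ i(2)] by blast
              next
                case False
                then show thesis using one[OF N le i] by force
              qed
            next
              case False
              then show thesis using none[OF N] by force
            qed
          qed
        qed
        then show "?W a \<longleftrightarrow> nim_condition V a"
        proof cases
          case large
          then have "N > 0" by (smt (verit) one_le_power)
          then have "V \<noteq> {}" unfolding N_def by auto
          then obtain i where i: "i \<in> V" by blast
          have "\<not> ?W a"
          \<comment> \<open>Here s = 0: the \<open>2 ^ Suc e\<close>-th power of the form is already
            zero in the quotient.\<close>
          proof (rule not_inj[OF i, of 0 "Suc e"])
            show "Suc (a h) \<le> 2 ^ Suc e" if "h \<in> V" for h using a that by (simp add: Suc_le_eq)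
            then show "Suc (a i) \<le> 2 ^ Suc e + 0" using i by simp
            show "2 * (int 0 + 2 ^ Suc e - 1) < N" using large by simp
          qed auto
          \<comment> \<open>The violated instance is \<open>k = Suc e\<close>, where
            \<open>tau\<close> is the identity on all entries and the inequality contradicts the
            case assumption.\<close>
          moreover have "\<not> nim_condition V a"
          proof
            assume "nim_condition V a"
            moreover have "nim_below V (Suc (Suc e)) a"
              by (rule nim_below_bound) (use a in force)
            moreover have "tau (2 ^ Suc e) (a h) = int (a h)" if "h \<in> V" for h
              using a that by (intro tau_small) auto
            then have "(\<Sum>h\<in>V. tau (2 ^ Suc e) (a h)) = N" unfolding N_def by (rule sum.cong[OF refl])
            moreover have "a h mod 2 ^ Suc (Suc e) \<noteq> 2 ^ Suc (Suc e) - 1" if "h \<in> V" for h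
            proof -
              have "a h < 2 ^ Suc e" using a that by blast
              moreover have "(2::nat) ^ Suc (Suc e) = 2 ^ Suc e + 2 ^ Suc e" "(1::nat) \<le> 2 ^ Suc e" by simp_all
              ultimately have "a h < 2 ^ Suc (Suc e) - 1" by linarith
              moreover from this have "a h mod 2 ^ Suc (Suc e) = a h" by (intro mod_less) linarith
              ultimately show ?thesis by linarith
            qed
            ultimately show False using large unfolding nim_condition_def by force
          qed
          ultimately show ?thesis by blast
        next
          case (max i)
          have "?W a"
            by (rule dominant[of i]) (use max in \<open>simp_all add: of_nat_diff\<close>)
          then show ?thesis using nim_condition_if_max[of i V a e] max unfolding N_def by blast
        next
          case (two i j)
          \<comment> \<open>For the powers \<open>Suc (a i)\<close> this is the exchange with
            \<open>2 ^ Suc e - Suc (a i)\<close> of the flip lemma. It lowers both entries because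
            they are at least \<open>2 ^ e\<close>, and it is an involution, so the lemma serves in
            both directions.\<close>
          define a' where "a' = a(i := 2 * 2 ^ e - 2 - a i, j := 2 * 2 ^ e - 2 - a j)"
          have ai: "a' i < a i" "a' j < a j" "a' i + 2 \<le> 2 ^ Suc e" "a' j + 2 \<le> 2 ^ Suc e"
            "a' i = 2 * 2 ^ e - 2 - a i" "a' j = 2 * 2 ^ e - 2 - a j"
          proof -
            have "2 ^ e \<ge> (1::nat)" by simp
            then show "a' i < a i" "a' j < a j" "a' i + 2 \<le> 2 ^ Suc e" "a' j + 2 \<le> 2 ^ Suc e"
              "a' i = 2 * 2 ^ e - 2 - a i" "a' j = 2 * 2 ^ e - 2 - a j"
              using two unfolding a'_def power_Suc by (auto simp del: One_nat_def)
          qed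
          have other: "a' h = a h" if "h \<noteq> i" "h \<noteq> j" for h using that unfolding a'_def by auto
          have le: "a' h \<le> a h" for h using ai other by (metis less_imp_le order_refl)
          have "sum a' V < sum a V"
            by (rule sum_strict_mono_ex1[OF fin]) (use le ai(1) two(3) in blast)+
          moreover have a'V: "\<forall>i\<in>V. a' i < 2 ^ Suc e" using a le by (meson le_less_trans)
          ultimately have IH: "?W a' \<longleftrightarrow> nim_condition V a'" using IHa by blast
          have N': "(\<Sum>i\<in>V. int (a' i)) \<le> 2 * 2 ^ Suc e - 2"
            using two(1) sum_mono[of V "\<lambda>i. int (a' i)" "\<lambda>i. int (a i)"] le unfolding N_def by force
          have flip: "(\<lambda>h. Suc (a' h)) = (\<lambda>h. Suc (a h))(i := 2 ^ Suc e - Suc (a i), j := 2 ^ Suc e - Suc (a j))"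
            "(\<lambda>h. Suc (a h)) = (\<lambda>h. Suc (a' h))(i := 2 ^ Suc e - Suc (a' i), j := 2 ^ Suc e - Suc (a' j))"
            using two ai other by (auto simp: fun_eq_iff)
          have "?W a" if "?W a'"
            by (rule injective_below_middle_flip[OF \<open>2 = 0\<close> fin two(3-5), of _ _ e])
              (use a two(1) two(3,4) c that in \<open>auto simp: Suc_le_eq sum_int_Suc N_def flip(1)\<close>)
          moreover have "?W a'" if "?W a"
            by (rule injective_below_middle_flip[OF \<open>2 = 0\<close> fin two(3-5), of _ _ e])
              (use a'V N' two(3,4) c that in \<open>auto simp: Suc_le_eq sum_int_Suc flip(2)\<close>)
          moreover have "nim_condition V a' \<longleftrightarrow> nim_condition V a"
          proof -
            \<comment> \<open>The conditions agree for each \<open>k\<close> separately. Up to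
              \<open>e\<close>, an all-ones residue survives reflection, and without one the digit
              parities and the \<open>tau\<close> sum are preserved; beyond \<open>e\<close> both
              inequalities hold by size.\<close>
            have "(nim_below V (Suc k) a' \<longrightarrow>
                (\<exists>i\<in>V. a' i mod 2 ^ Suc k = 2 ^ Suc k - 1) \<or> (\<Sum>i\<in>V. tau (2 ^ k) (a' i)) \<le> 2 * 2 ^ k - 2) \<longleftrightarrow>
              (nim_below V (Suc k) a \<longrightarrow>
                (\<exists>i\<in>V. a i mod 2 ^ Suc k = 2 ^ Suc k - 1) \<or> (\<Sum>i\<in>V. tau (2 ^ k) (a i)) \<le> 2 * 2 ^ k - 2)" for k
            proof (cases "k \<le> e")
              case True
              have *: "2 * 2 ^ e = 2 ^ Suc k * (2 ^ (e - k) :: nat)" using True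
                by (simp add: power_add[symmetric])
              have "a' h mod 2 ^ Suc k = 2 ^ Suc k - 1 \<longleftrightarrow> a h mod 2 ^ Suc k = 2 ^ Suc k - 1" if "h \<in> V" for h
              proof (cases "h = i \<or> h = j")
                case True
                then have "a' h = 2 ^ Suc k * 2 ^ (e - k) - 2 - a h" using ai * by auto
                then show ?thesis
                  using reflect_mod_max_iff[of "a h" "Suc k" "2 ^ (e - k)"] two(2) that * by auto
              qed (use other in auto)
              then have "(\<exists>i\<in>V. a' i mod 2 ^ Suc k = 2 ^ Suc k - 1) \<longleftrightarrow> (\<exists>i\<in>V. a i mod 2 ^ Suc k = 2 ^ Suc k - 1)"
                by blast
              then show ?thesis
                using nim_condition_reflect[OF fin two(3-5) _ a'_def True] two(2) by auto
            next
              case False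
              then show ?thesis using nim_condition_below[OF N', of k] nim_condition_below[of a V e k] two(1)
                unfolding N_def by auto
            qed
            then show ?thesis unfolding nim_condition_def by simp
          qed
          ultimately show ?thesis using IH by blast
        next
          case (one i)
          have split: "N = int (a i) + (\<Sum>h\<in>V - {i}. int (a h))"
            unfolding N_def by (rule sum.remove[OF fin one(3)])
          \<comment> \<open>Only the entry \<open>i\<close> lies on the descending branch of
            \<open>tau\<close>, so it alone enters with reversed sign.\<close>
          have nimt: "(\<Sum>h\<in>V. tau (2 ^ e) (a h)) = 2 * 2 ^ e - 2 + N - 2 * int (a i)"
          proof -
            have "(\<Sum>h\<in>V. tau (2 ^ e) (a h)) = tau (2 ^ e) (a i) + (\<Sum>h\<in>V - {i}. tau (2 ^ e) (a h))"
              by (rule sum.remove[OF fin one(3)])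
            also have "(\<Sum>h\<in>V - {i}. tau (2 ^ e) (a h)) = (\<Sum>h\<in>V - {i}. int (a h))"
              by (intro sum.cong refl tau_small) (use one in auto)
            also have "tau (2 ^ e) (a i) = 2 * 2 ^ e - 2 - int (a i)"
              using tau_large[of "2 ^ e" "a i"] one a by simp
            finally show ?thesis using split by simp
          qed
          show ?thesis
          proof (cases "N \<le> 2 * int (a i)")
            case True
            have "?W a" by (rule dominant[of i]) (use one True in auto)
            moreover have "nim_condition V a"
              unfolding nim_condition_def
            proof (intro allI impI)
              fix k :: nat assume k: "nim_below V (Suc k) a"
              consider "k < e" | "k = e" | "e < k" by linarith
              then show "(\<exists>i\<in>V. a i mod 2 ^ Suc k = 2 ^ Suc k - 1) \<or> (\<Sum>i\<in>V. tau (2 ^ k) (a i)) \<le> 2 * 2 ^ k - 2"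
              proof cases
                \<comment> \<open>Digit \<open>e\<close> is set in \<open>a i\<close> and in no
                  other entry, so the hypothesis \<open>nim_below\<close> is false.\<close>
                case 1
                then have "even (\<Sum>h\<in>V. of_bool (bit (a h) e) :: nat)" using k unfolding nim_below_def by auto
                also have "(\<Sum>h\<in>V. of_bool (bit (a h) e) :: nat) = of_bool (bit (a i) e) + (\<Sum>h\<in>V - {i}. of_bool (bit (a h) e))"
                  by (rule sum.remove[OF fin one(3)])
                also have "(\<Sum>h\<in>V - {i}. of_bool (bit (a h) e) :: nat) = (\<Sum>h\<in>V - {i}. 0)"
                  by (intro sum.cong refl) (use one(5) not_bit_ge[of _ e e] in force)
                finally show ?thesis using bit_top[of "a i" e] one a by simp
              next
                case 2
                then show ?thesis using nimt True by simp
              next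
                case 3
                then show ?thesis using nim_condition_below[of a V e k] one(1) unfolding N_def by blast
              qed
            qed
            ultimately show ?thesis by blast
          next
            case False
            have "\<not> ?W a"
            \<comment> \<open>This is the least s that the lemma admits; its degree bound becomes
              exactly \<open>2 * int (a i) < N\<close>.\<close>
            proof (rule not_inj[OF one(3), of "Suc (a i) - 2 ^ e" e])
              show "2 * (int (Suc (a i) - 2 ^ e) + 2 ^ e - 1) < N"
                using False one(4) by (simp add: of_nat_diff)
            qed (use one in \<open>auto simp: Suc_le_eq\<close>)
            moreover have "\<not> nim_condition V a"
            proof
              assume C: "nim_condition V a"
              \<comment> \<open>\<open>nim_condition\<close> starts at \<open>k = 1\<close>. For
                \<open>e = 0\<close> the entry \<open>a i\<close> would be
                \<open>2 ^ Suc e - 1\<close>, which is excluded here.\<close>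
              have "e \<noteq> 0"
              proof
                assume "e = 0"
                moreover have "a i + 2 \<le> 2 ^ Suc e" using one by blast
                ultimately show False using one(4) by simp
              qed
              moreover have "nim_below V (Suc e) a" using a by (intro nim_below_bound) auto
              moreover have "\<forall>h\<in>V. a h mod 2 ^ Suc e \<noteq> 2 ^ Suc e - 1"
              proof
                fix h assume h: "h \<in> V"
                then have "a h mod 2 ^ Suc e = a h" using a by (intro mod_less) blast
                moreover have "a h + 2 \<le> 2 ^ Suc e" using one(2) h by blast
                ultimately show "a h mod 2 ^ Suc e \<noteq> 2 ^ Suc e - 1" by linarith
              qed
              ultimately have "(\<Sum>h\<in>V. tau (2 ^ e) (a h)) \<le> 2 * 2 ^ e - 2"
                using C unfolding nim_condition_def by (metis One_nat_def Suc_leI not_gr_zero)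
              then show False using nimt False by simp
            qed
            ultimately show ?thesis by blast
          qed
        next
          case none
          show ?thesis
          proof (cases e)
            case 0
            then have "a i = 0" if "i \<in> V" for i using none(2) that by auto
            then have N0: "N = 0" unfolding N_def by simp
            have "?W a"
              unfolding injective_below_middle_def sum_int_Suc
            proof (intro allI impI)
              fix D and x :: "'k mpoly"
              assume "2 * D < (\<Sum>i\<in>V. int (a i))" "x \<in> piece V D"
              then have "Poly_Mapping.keys x = {}" using N0 unfolding N_def piece_def by force
              then show "x \<in> monomial_ideal V (\<lambda>i. Suc (a i))" unfolding monomial_ideal_def by simp
            qed
            moreover have "nim_condition V a"
              unfolding nim_condition_def using nim_condition_below[of a V 0] N0 0 unfolding N_def by auto
            ultimately show ?thesis by blast
          next
            case (Suc e')
            then show ?thesis using IHe[of e' a] none(2) by auto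
          qed
        qed
      qed
    qed
  qed
  have "a i < 2 ^ Suc (sum a V)" if "i \<in> V" for i
  proof -
    have "a i \<le> sum a V" by (rule member_le_sum) (use fin that in auto)
    also have "\<dots> < 2 ^ sum a V" by (rule less_exp)
    finally show ?thesis by simp
  qed
  then show ?thesis using main by blast
qed

section \<open>Maximal rank and duality\<close>

lemma (in vector_space) exists_separating_functional:
  assumes S: "subspace S" and y: "y \<notin> S"
  shows "\<exists>\<psi>. Vector_Spaces.linear scale (*) \<psi> \<and> (\<forall>x\<in>S. \<psi> x = 0) \<and> \<psi> y = 1"
proof -
  interpret field: vector_space "(*) :: 'a \<Rightarrow> 'a \<Rightarrow> 'a"
    by unfold_locales (simp_all add: algebra_simps)
  interpret vector_space_pair scale "(*) :: 'a \<Rightarrow> 'a \<Rightarrow> 'a" ..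
  obtain B where B: "B \<subseteq> S" "independent B" "S \<subseteq> span B"
    using maximal_independent_subset by blast
  have spanB: "span B = S" using B S by (simp add: span_minimal subset_antisym)
  have yB: "y \<notin> B" using B(1) y by blast
  have "independent (insert y B)" using B y spanB by (simp add: independent_insertI)
  then obtain \<psi> where \<psi>: "Vector_Spaces.linear scale (*) \<psi>" "\<forall>x\<in>insert y B. \<psi> x = (if x = y then 1 else 0)"
    using linear_independent_extend[of "insert y B" "\<lambda>x. if x = y then 1 else 0"] by blast
  have "\<psi> x = 0" if "x \<in> S" for x
  proof (rule linear_eq_0_on_span[OF \<psi>(1)])
    show "\<psi> b = 0" if "b \<in> B" for b using \<psi>(2) yB that by auto
    show "x \<in> span B" using that spanB by simp
  qed
  then show ?thesis using \<psi> by auto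
qed

section \<open>Complementary monomials\<close>

lemma submonomial_of_degree:
  assumes "k \<le> monomial_degree m"
  obtains u v where "m = u + v" "monomial_degree u = k"
proof -
  have "\<exists>u v. m = u + v \<and> monomial_degree u = k" using assms
  proof (induction k)
    case 0
    show ?case by (rule exI[of _ 0], rule exI[of _ m]) simp
  next
    case (Suc k)
    then obtain u v where uv: "m = u + v" "monomial_degree u = k" by auto
    have "v \<noteq> 0" using Suc.prems uv by auto
    then obtain i where i: "Poly_Mapping.lookup v i \<noteq> 0" by (metis poly_mapping_eqI lookup_zero)
    have "v = Poly_Mapping.single i 1 + (v - Poly_Mapping.single i 1)"
      using i by (intro poly_mapping_eqI) (auto simp: lookup_add lookup_minus lookup_single when_def)
    then have "m = (u + Poly_Mapping.single i 1) + (v - Poly_Mapping.single i 1)"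
      using uv(1) by (metis add.assoc)
    moreover have "monomial_degree (u + Poly_Mapping.single i 1) = Suc k" using uv by simp
    ultimately show ?case by blast
  qed
  then show thesis using that by blast
qed

lemma finite_monomials_of_degree:
  assumes "finite V"
  shows "finite {m. Poly_Mapping.keys m \<subseteq> V \<and> monomial_degree m = d}"
proof -
  have "finite {f. \<forall>x. (x \<in> V \<longrightarrow> f x \<in> {..d}) \<and> (x \<notin> V \<longrightarrow> f x = (0::nat))}"
    by (rule finite_set_of_finite_funs) (use assms in auto)
  moreover have "Poly_Mapping.lookup ` {m. Poly_Mapping.keys m \<subseteq> V \<and> monomial_degree m = d}
      \<subseteq> {f. \<forall>x. (x \<in> V \<longrightarrow> f x \<in> {..d}) \<and> (x \<notin> V \<longrightarrow> f x = 0)}"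
    using lookup_le_monomial_degree by (auto simp: in_keys_iff)
  ultimately have "finite (Poly_Mapping.lookup ` {m. Poly_Mapping.keys m \<subseteq> V \<and> monomial_degree m = d})"
    by (rule finite_subset[rotated])
  then show ?thesis by (rule finite_imageD) (simp add: inj_on_def poly_mapping.lookup_inject)
qed

lemma single_piece:
  "Poly_Mapping.keys m \<subseteq> V \<Longrightarrow> int (monomial_degree m) = D \<Longrightarrow> Poly_Mapping.single m u \<in> piece V D"
  unfolding piece_def by auto

text \<open>The generator of the socle: the monomials in the variables of \<open>V\<close> that
  survive in the quotient are its divisors.\<close>

definition top_monomial :: "nat set \<Rightarrow> (nat \<Rightarrow> nat) \<Rightarrow> nat \<Rightarrow>\<^sub>0 nat" where
  "top_monomial V a = (\<Sum>i\<in>V. Poly_Mapping.single i (a i))"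

lemma lookup_top_monomial:
  "finite V \<Longrightarrow> Poly_Mapping.lookup (top_monomial V a) i = (if i \<in> V then a i else 0)"
  unfolding top_monomial_def by (simp add: lookup_sum lookup_single when_def)

lemma monomial_complement:
  assumes fin: "finite V" and m: "Poly_Mapping.keys m \<subseteq> V" "\<forall>h\<in>V. Poly_Mapping.lookup m h \<le> a h"
  shows "(top_monomial V a - m) + m = top_monomial V a"
    "Poly_Mapping.keys (top_monomial V a - m) \<subseteq> V"
    "int (monomial_degree (top_monomial V a - m)) = (\<Sum>i\<in>V. int (a i)) - int (monomial_degree m)"
proof -
  show *: "(top_monomial V a - m) + m = top_monomial V a"
    using m by (intro poly_mapping_eqI) (auto simp: lookup_add lookup_minus lookup_top_monomial[OF fin] in_keys_iff)
  show k: "Poly_Mapping.keys (top_monomial V a - m) \<subseteq> V"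
    by (auto simp: in_keys_iff lookup_minus lookup_top_monomial[OF fin] split: if_splits)
  have "monomial_degree (top_monomial V a) = (\<Sum>i\<in>V. a i)"
    by (subst monomial_degree_alt[OF fin]) (auto simp: in_keys_iff lookup_top_monomial[OF fin] split: if_splits)
  moreover have "monomial_degree (top_monomial V a) = monomial_degree (top_monomial V a - m) + monomial_degree m"
    using * monomial_degree_add by metis
  ultimately show "int (monomial_degree (top_monomial V a - m)) = (\<Sum>i\<in>V. int (a i)) - int (monomial_degree m)"
    by (metis add_diff_cancel_right' of_nat_add of_nat_sum)
qed

lemma lookup_top_monomial_ideal:
  assumes "finite V" "p \<in> monomial_ideal V (\<lambda>i. Suc (a i))"
  shows "Poly_Mapping.lookup p (top_monomial V a) = 0"
proof (rule ccontr)
  assume "Poly_Mapping.lookup p (top_monomial V a) \<noteq> 0"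
  then have "top_monomial V a \<in> Poly_Mapping.keys p" by (simp add: in_keys_iff)
  then obtain h where "h \<in> V" "Suc (a h) \<le> Poly_Mapping.lookup (top_monomial V a) h"
    using assms(2) unfolding monomial_ideal_def by blast
  then show False using lookup_top_monomial[OF assms(1)] by simp
qed

lemma not_in_monomial_ideal:
  assumes "x \<in> piece V D" "x \<notin> monomial_ideal V (\<lambda>i. Suc (a i))"
  obtains m where "m \<in> Poly_Mapping.keys x" "Poly_Mapping.keys m \<subseteq> V" "int (monomial_degree m) = D"
    "\<forall>h\<in>V. Poly_Mapping.lookup m h \<le> a h"
  using assms unfolding piece_def monomial_ideal_def by (auto simp: not_less_eq_eq)

definition mult_injective :: "nat set \<Rightarrow> (nat \<Rightarrow> nat) \<Rightarrow> 'k::comm_ring_1 mpoly \<Rightarrow> nat \<Rightarrow> bool" where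
  "mult_injective V a l d \<longleftrightarrow> (\<forall>x\<in>piece V (int d).
    l * x \<in> monomial_ideal V (\<lambda>i. Suc (a i)) \<longrightarrow> x \<in> monomial_ideal V (\<lambda>i. Suc (a i)))"

definition mult_surjective :: "nat set \<Rightarrow> (nat \<Rightarrow> nat) \<Rightarrow> 'k::comm_ring_1 mpoly \<Rightarrow> nat \<Rightarrow> bool" where
  "mult_surjective V a l d \<longleftrightarrow> (\<forall>y\<in>piece V (int d + 1). \<exists>x\<in>piece V (int d).
    y - l * x \<in> monomial_ideal V (\<lambda>i. Suc (a i)))"

text \<open>A nonzero kernel element x in a degree d below the middle forces surjectivity there, so
  every monomial of degree d + 1 is a multiple of l and kills x. But the complement of a surviving
  monomial of x has degree at least d + 1, and its product with x has a nonzero top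
  coefficient.\<close>

lemma mult_injective_or_surjective_imp_injective_below_middle:
  fixes c :: "nat \<Rightarrow> 'k::field"
  assumes fin: "finite V"
    and *: "\<And>d. mult_injective V a (linear_form V c) d \<or> mult_surjective V a (linear_form V c) d"
  shows "injective_below_middle V c (\<lambda>i. Suc (a i))"
  unfolding injective_below_middle_def
proof (intro allI impI, rule ccontr)
  fix D and x :: "'k mpoly"
  let ?J = "monomial_ideal V (\<lambda>i. Suc (a i)) :: 'k mpoly set"
  assume "2 * D < (\<Sum>i\<in>V. int (Suc (a i)) - 1)" and x: "x \<in> piece V D"
    and lx: "linear_form V c * x \<in> ?J" and nx: "x \<notin> ?J"
  then have D: "2 * D < (\<Sum>i\<in>V. int (a i))" by simp
  obtain m where m: "m \<in> Poly_Mapping.keys x" "Poly_Mapping.keys m \<subseteq> V" "int (monomial_degree m) = D"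
    "\<forall>h\<in>V. Poly_Mapping.lookup m h \<le> a h" by (rule not_in_monomial_ideal[OF x nx])
  define d where "d = monomial_degree m"
  have "\<not> mult_injective V a (linear_form V c) d"
    using x lx nx m(3) unfolding mult_injective_def d_def by auto
  then have surj: "mult_surjective V a (linear_form V c) d" using * by blast
  define m' where "m' = top_monomial V a - m"
  note m' = monomial_complement[OF fin m(2,4), folded m'_def]
  have "Suc d \<le> monomial_degree m'" using m'(3) m(3) D unfolding d_def by linarith
  then obtain u v where uv: "m' = u + v" "monomial_degree u = Suc d"
    by (rule submonomial_of_degree)
  have "Poly_Mapping.single u (1::'k) \<in> piece V (int d + 1)"
    using uv m'(2) by (intro single_piece) (auto simp: keys_add_nat)
  then obtain r where r: "r \<in> piece V (int d)" "Poly_Mapping.single u 1 - linear_form V c * r \<in> ?J"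
    using surj unfolding mult_surjective_def by blast
  have "Poly_Mapping.single m' 1 * x = (x * Poly_Mapping.single v 1) * (Poly_Mapping.single u 1 - linear_form V c * r)
      + (r * Poly_Mapping.single v 1) * (linear_form V c * x)"
    unfolding uv by (simp add: algebra_simps mult_single)
  also have "\<dots> \<in> ?J"
    by (intro monomial_ideal_add monomial_ideal_mult[OF r(2)] monomial_ideal_mult[OF lx])
  finally have "Poly_Mapping.lookup (Poly_Mapping.single m' 1 * x) (m' + m) = 0"
    unfolding m'(1) by (rule lookup_top_monomial_ideal[OF fin])
  then show False using m(1) by (simp add: lookup_single_mult in_keys_iff)
qed

text \<open>
  Surjectivity above the middle is dual to injectivity below it: the coefficient of the top monomial
  in a product is a perfect pairing of complementary degrees.
\<close>

lemma injective_below_middle_imp_mult_injective_or_surjective: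
  fixes c :: "nat \<Rightarrow> 'k::field"
  assumes fin: "finite V" and inj: "injective_below_middle V c (\<lambda>i. Suc (a i))"
  shows "mult_injective V a (linear_form V c) d \<or> mult_surjective V a (linear_form V c) d"
proof (cases "2 * int d < (\<Sum>i\<in>V. int (a i))")
  case True
  then show ?thesis using inj unfolding injective_below_middle_def mult_injective_def by simp
next
  case False
  define N where "N = (\<Sum>i\<in>V. int (a i))"
  define J where "J = (monomial_ideal V (\<lambda>i. Suc (a i)) :: 'k mpoly set)"
  define l where "l = linear_form V c"
  define t where "t = top_monomial V a"
  have "mult_surjective V a l d"
    unfolding mult_surjective_def J_def[symmetric]
  proof (rule ccontr)
    assume "\<not> (\<forall>y\<in>piece V (int d + 1). \<exists>x\<in>piece V (int d). y - l * x \<in> J)"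
    then obtain y where y: "y \<in> piece V (int d + 1)" "\<And>x. x \<in> piece V (int d) \<Longrightarrow> y - l * x \<notin> J" by blast
    \<comment> \<open>\<open>S\<close> contains the ideal as well as the image, so a functional
      vanishing on \<open>S\<close> depends only on classes modulo \<open>J\<close>.\<close>
    define S where "S = {p. \<exists>x\<in>piece V (int d). p - l * x \<in> J}"
    interpret vector_space "\<lambda>c p. Poly_Mapping.single 0 c * p :: 'k mpoly"
      by unfold_locales (simp_all add: algebra_simps single_add mult_single mult.assoc[symmetric])
    have "subspace S"
      unfolding subspace_def
    proof (intro conjI ballI allI)
      show "0 \<in> S" unfolding S_def J_def by (auto intro!: bexI[of _ 0])
    next
      fix p q assume "p \<in> S" "q \<in> S"
      then obtain x x' where x: "x \<in> piece V (int d)" "p - l * x \<in> J" "x' \<in> piece V (int d)" "q - l * x' \<in> J"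
        unfolding S_def by blast
      have "p + q - l * (x + x') \<in> J"
        using monomial_ideal_add[OF x(2,4)[unfolded J_def]] unfolding J_def by (simp add: algebra_simps)
      then show "p + q \<in> S" unfolding S_def using piece_add[OF x(1,3)] by blast
    next
      fix u :: 'k and p assume "p \<in> S"
      then obtain x where x: "x \<in> piece V (int d)" "p - l * x \<in> J" unfolding S_def by blast
      have "Poly_Mapping.single 0 u * p - l * (Poly_Mapping.single 0 u * x) \<in> J"
        using monomial_ideal_mult[OF x(2)[unfolded J_def], of "Poly_Mapping.single 0 u"]
        unfolding J_def by (simp add: algebra_simps)
      moreover have "Poly_Mapping.single 0 u * x \<in> piece V (int d)"
        by (rule piece_mult'[OF _ x(1), of _ 0]) (auto intro: single_piece)
      ultimately show "Poly_Mapping.single 0 u * p \<in> S" unfolding S_def by blast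
    qed
    moreover have "y \<notin> S" using y unfolding S_def by blast
    ultimately obtain \<psi> where \<psi>: "Vector_Spaces.linear (\<lambda>c p. Poly_Mapping.single 0 c * p) (*) \<psi>"
      "\<And>x. x \<in> S \<Longrightarrow> \<psi> x = 0" "\<psi> y = 1"
      using exists_separating_functional by blast
    interpret \<psi>: Vector_Spaces.linear "\<lambda>c p. Poly_Mapping.single 0 c * p" "(*)" \<psi> by (rule \<psi>(1))
    have J_S: "p \<in> S" if "p \<in> J" for p unfolding S_def using that by (auto intro!: bexI[of _ 0])
    define M where "M = {m. (Poly_Mapping.keys m \<subseteq> V \<and> monomial_degree m = d + 1) \<and> (\<forall>h\<in>V. Poly_Mapping.lookup m h \<le> a h)}"
    have finM: "finite M"
      by (rule finite_subset[OF _ finite_monomials_of_degree[OF fin, of "d + 1"]]) (auto simp: M_def)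
    have M: "(t - m) + m = t" "Poly_Mapping.keys (t - m) \<subseteq> V"
      "int (monomial_degree (t - m)) = N - int d - 1" if "m \<in> M" for m
      using monomial_complement[OF fin, of m a] that unfolding M_def t_def N_def by auto
    \<comment> \<open>\<open>z\<close> represents \<open>\<psi>\<close> under the pairing: its
      coefficient at the complement of a monomial is the value of \<open>\<psi>\<close> there. The
      other monomials of degree \<open>d + 1\<close> lie in \<open>J\<close>, where
      \<open>\<psi>\<close> vanishes.\<close>
    define z where "z = (\<Sum>m\<in>M. Poly_Mapping.single (t - m) (\<psi> (Poly_Mapping.single m 1)))"
    have z: "z \<in> piece V (N - int d - 1)"
      unfolding z_def by (intro piece_sum single_piece M)
    have pairing: "Poly_Mapping.lookup (z * p) t = \<psi> p" if p: "p \<in> piece V (int d + 1)" for p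
    proof -
      have "\<psi> p = \<psi> (\<Sum>m\<in>Poly_Mapping.keys p. Poly_Mapping.single 0 (Poly_Mapping.lookup p m) * Poly_Mapping.single m 1)"
        by (simp add: mult_single poly_mapping_sum_single)
      also have "\<dots> = (\<Sum>m\<in>Poly_Mapping.keys p. Poly_Mapping.lookup p m * \<psi> (Poly_Mapping.single m 1))"
        by (simp only: \<psi>.sum \<psi>.scale)
      also have "\<dots> = (\<Sum>m\<in>M. Poly_Mapping.lookup p m * \<psi> (Poly_Mapping.single m 1))"
      proof (rule sum.mono_neutral_cong)
        fix m assume m: "m \<in> Poly_Mapping.keys p - M"
        then have "\<not> (\<forall>h\<in>V. Poly_Mapping.lookup m h \<le> a h)"
          using p unfolding piece_def M_def by auto
        then have "Poly_Mapping.single m 1 \<in> J"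
          unfolding J_def monomial_ideal_def by (auto simp: Suc_le_eq not_le)
        then show "Poly_Mapping.lookup p m * \<psi> (Poly_Mapping.single m 1) = 0"
          using \<psi>(2)[OF J_S] by simp
      qed (use finM in \<open>auto simp: in_keys_iff\<close>)
      also have "\<dots> = Poly_Mapping.lookup (z * p) t"
        unfolding z_def sum_distrib_right lookup_sum
      proof (rule sum.cong[OF refl])
        fix m assume "m \<in> M"
        then have "Poly_Mapping.lookup (Poly_Mapping.single (t - m) (\<psi> (Poly_Mapping.single m 1)) * p) t
            = \<psi> (Poly_Mapping.single m 1) * Poly_Mapping.lookup p m"
          by (metis M(1) lookup_single_mult)
        then show "Poly_Mapping.lookup p m * \<psi> (Poly_Mapping.single m 1) =
            Poly_Mapping.lookup (Poly_Mapping.single (t - m) (\<psi> (Poly_Mapping.single m 1)) * p) t" by simp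
      qed
      finally show ?thesis by simp
    qed
    \<comment> \<open>For every \<open>w\<close> of degree \<open>d\<close> the coefficient of
      \<open>t\<close> in \<open>z * (l * w)\<close> is \<open>\<psi> (l * w)\<close>, which is 0. A
      surviving monomial of \<open>l * z\<close> would be detected by taking its complement for
      \<open>w\<close>.\<close>
    have lz: "l * z \<in> J"
    proof (rule ccontr)
      assume "l * z \<notin> J"
      moreover have lzV: "l * z \<in> piece V (N - int d)"
        unfolding l_def by (rule piece_mult'[OF piece_linear_form z]) simp
      ultimately obtain m where m: "m \<in> Poly_Mapping.keys (l * z)" "Poly_Mapping.keys m \<subseteq> V"
        "int (monomial_degree m) = N - int d" "\<forall>h\<in>V. Poly_Mapping.lookup m h \<le> a h"
        unfolding J_def by (metis not_in_monomial_ideal)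
      note m' = monomial_complement[OF fin m(2,4), folded t_def]
      define w where "w = Poly_Mapping.single (t - m) (1::'k)"
      have w: "w \<in> piece V (int d)"
        unfolding w_def using m'(2,3) m(3) by (intro single_piece) (auto simp: N_def)
      have "l * w \<in> S" unfolding S_def J_def using w by (auto intro!: bexI[of _ w])
      then have "\<psi> (l * w) = 0" by (rule \<psi>(2))
      moreover have "l * w \<in> piece V (int d + 1)"
        unfolding l_def by (rule piece_mult'[OF piece_linear_form w]) simp
      ultimately have "Poly_Mapping.lookup (z * (l * w)) t = 0" using pairing by simp
      moreover have "z * (l * w) = w * (l * z)" by (simp add: ac_simps)
      ultimately have "Poly_Mapping.lookup (w * (l * z)) ((t - m) + m) = 0" using m'(1) by simp
      then show False using m(1) unfolding w_def lookup_single_mult by (simp add: in_keys_iff)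
    qed
    \<comment> \<open>As \<open>2 * int d\<close> is at least \<open>N\<close>, the degree of
      \<open>z\<close> lies below the middle. Pairing \<open>z\<close> with \<open>y\<close> then
      gives 0 instead of 1.\<close>
    have "z \<in> J"
    proof -
      have "2 * (N - int d - 1) < (\<Sum>i\<in>V. int (Suc (a i)) - 1)" using False unfolding N_def by simp
      then show ?thesis using inj z lz unfolding injective_below_middle_def J_def l_def by blast
    qed
    then have "y * z \<in> J" unfolding J_def by (rule monomial_ideal_mult)
    then have "Poly_Mapping.lookup (y * z) t = 0"
      unfolding J_def t_def by (rule lookup_top_monomial_ideal[OF fin])
    then show False using pairing[OF y(1)] \<psi>(3) by (simp add: mult.commute)
  qed
  then show ?thesis unfolding l_def by blast
qed

section \<open>Ranks in the quotient ring\<close>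

context cring
begin

lemma dimension_mono_eq:
  assumes K: "subfield K R" and E: "dimension m K E" and F: "dimension n K F" and "E \<subseteq> F"
  shows "m \<le> n" "m = n \<Longrightarrow> E = F"
proof -
  obtain Vs where Vs: "set Vs \<subseteq> carrier R" "independent K Vs" "length Vs = m" "Span K Vs = E"
    using exists_base[OF K E] by blast
  have sub: "set Vs \<subseteq> F" using Span_base_incl[OF K Vs(1)] Vs(4) \<open>E \<subseteq> F\<close> by blast
  show "m \<le> n"
    using independent_length_le_dimension[OF K F Vs(2) sub] Vs(3) by simp
  show "E = F" if "m = n"
  proof (rule ccontr)
    assume "E \<noteq> F"
    then obtain x where x: "x \<in> F" "x \<notin> E" using \<open>E \<subseteq> F\<close> by blast
    then have "independent K (x # Vs)"
      using Vs space_subgroup_props(1)[OF K F] by (intro li_Cons) auto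
    then have "Suc m \<le> n"
      using independent_length_le_dimension[OF K F, of "x # Vs"] sub x(1) Vs(3) by simp
    then show False using that by simp
  qed
qed

lemma inj_on_mult_iff:
  assumes K: "subfield K R" and l: "l \<in> carrier R" and E: "dimension d K E"
  shows "inj_on ((\<otimes>) l) E \<longleftrightarrow> (\<forall>x\<in>E. l \<otimes> x = \<zero> \<longrightarrow> x = \<zero>)"
proof
  assume "inj_on ((\<otimes>) l) E"
  then show "\<forall>x\<in>E. l \<otimes> x = \<zero> \<longrightarrow> x = \<zero>"
    using space_subgroup_props(2)[OF K E] l unfolding inj_on_def by (metis r_null)
next
  assume *: "\<forall>x\<in>E. l \<otimes> x = \<zero> \<longrightarrow> x = \<zero>"
  show "inj_on ((\<otimes>) l) E"
  proof (rule inj_onI)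
    fix x y assume xy: "x \<in> E" "y \<in> E" "l \<otimes> x = l \<otimes> y"
    then have c: "x \<in> carrier R" "y \<in> carrier R" using space_subgroup_props(1)[OF K E] by auto
    have "l \<otimes> (x \<ominus> y) = \<zero>"
      using xy(3) c l by (simp add: a_minus_def r_distr r_minus r_neg)
    moreover have "x \<ominus> y \<in> E"
      unfolding a_minus_def using xy space_subgroup_props(3,4)[OF K E] by blast
    ultimately have "x \<ominus> y = \<zero>" using * by blast
    then show "x = y" using c by (simp add: r_right_minus_eq)
  qed
qed

lemma dimension_mult_image:
  assumes K: "subfield K R" and l: "l \<in> carrier R" and E: "dimension d K E"
  shows "(inj_on ((\<otimes>) l) E \<longrightarrow> dimension d K ((\<otimes>) l ` E)) \<and>
    (\<not> inj_on ((\<otimes>) l) E \<longrightarrow> (\<exists>d'<d. dimension d' K ((\<otimes>) l ` E)))"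
  using E K
proof (induction d K E rule: dimension.induct)
  case (zero_dim K)
  then show ?case using l dimension.zero_dim[of K] by simp
next
  case (Suc_dim v E d K)
  note K = \<open>subfield K R\<close> and E = \<open>dimension d K E\<close> and v = \<open>v \<in> carrier R\<close> \<open>v \<notin> E\<close>
  note IH = Suc_dim.IH[OF K]
  let ?f = "(\<otimes>) l"
  have F: "dimension (Suc d) K (line_extension K v E)" using Suc_dim by (intro dimension.Suc_dim)
  have KR: "K \<subseteq> carrier R" using subfieldE(3)[OF K] .
  have ER: "E \<subseteq> carrier R" using space_subgroup_props(1)[OF K E] .
  have one: "\<one> \<in> K" and zero: "\<zero> \<in> K" using subringE(2,3)[OF subfieldE(1)[OF K]] by auto
  have f_comb: "?f (k \<otimes> v \<oplus> e) = k \<otimes> (l \<otimes> v) \<oplus> ?f e" if "k \<in> K" "e \<in> E" for k e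
    using that KR ER l v by (simp add: r_distr m_lcomm subset_iff)
  have image: "?f ` line_extension K v E = line_extension K (l \<otimes> v) (?f ` E)"
  proof
    show "?f ` line_extension K v E \<subseteq> line_extension K (l \<otimes> v) (?f ` E)"
      using f_comb by (force simp: line_extension_mem_iff)
    show "line_extension K (l \<otimes> v) (?f ` E) \<subseteq> ?f ` line_extension K v E"
    proof
      fix y assume "y \<in> line_extension K (l \<otimes> v) (?f ` E)"
      then obtain k e where ke: "k \<in> K" "e \<in> E" "y = k \<otimes> (l \<otimes> v) \<oplus> ?f e"
        by (auto simp: line_extension_mem_iff)
      then have "y = ?f (k \<otimes> v \<oplus> e)" using f_comb by simp
      moreover have "k \<otimes> v \<oplus> e \<in> line_extension K v E" using ke line_extension_mem_iff by blast
      ultimately show "y \<in> ?f ` line_extension K v E" by blast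
    qed
  qed
  have sub: "E \<subseteq> line_extension K v E"
  proof
    fix e assume e: "e \<in> E"
    then have "e = \<zero> \<otimes> v \<oplus> e" using v ER by auto
    then show "e \<in> line_extension K v E" using e zero line_extension_mem_iff by blast
  qed
  have vin: "v \<in> line_extension K v E"
  proof -
    have "v = \<one> \<otimes> v \<oplus> \<zero>" using v by simp
    then show ?thesis using one space_subgroup_props(2)[OF K E] line_extension_mem_iff by blast
  qed
  obtain d' where d': "d' \<le> d" "dimension d' K (?f ` E)" using IH by (metis less_imp_le order_refl)
  show ?case
  proof (cases "l \<otimes> v \<in> ?f ` E")
    case True
    have "line_extension K (l \<otimes> v) (?f ` E) = ?f ` E"
    proof
      show "line_extension K (l \<otimes> v) (?f ` E) \<subseteq> ?f ` E"
        using space_subgroup_props(3,5)[OF K d'(2)] True by (auto simp: line_extension_mem_iff)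
      show "?f ` E \<subseteq> line_extension K (l \<otimes> v) (?f ` E)"
        unfolding image[symmetric] using sub by blast
    qed
    moreover have "\<not> inj_on ?f (line_extension K v E)"
      using True sub vin v(2) unfolding inj_on_def by blast
    ultimately show ?thesis using d' image by (metis le_imp_less_Suc)
  next
    case False
    have dim: "dimension (Suc d'') K (?f ` line_extension K v E)" if "dimension d'' K (?f ` E)" for d''
      unfolding image using that False l v by (intro dimension.Suc_dim) auto
    have "inj_on ?f (line_extension K v E)" if inj: "inj_on ?f E"
      unfolding inj_on_mult_iff[OF K l F]
    proof (intro ballI impI)
      fix x assume "x \<in> line_extension K v E" and lx: "l \<otimes> x = \<zero>"
      then obtain k e where ke: "k \<in> K" "e \<in> E" "x = k \<otimes> v \<oplus> e" by (auto simp: line_extension_mem_iff)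
      have carr: "k \<in> carrier R" "e \<in> carrier R" using ke KR ER by auto
      have "k = \<zero>"
      proof (rule ccontr)
        assume "k \<noteq> \<zero>"
        have "k \<otimes> (l \<otimes> v) \<oplus> l \<otimes> e = \<zero>" using lx f_comb[OF ke(1,2)] unfolding ke(3) by simp
        then have "k \<otimes> (l \<otimes> v) = l \<otimes> (\<ominus> e)"
          using carr l v by (metis m_closed minus_equality r_minus)
        then have "k \<otimes> (l \<otimes> v) \<in> ?f ` E" using space_subgroup_props(4)[OF K E ke(2)] by blast
        then have "l \<otimes> v \<in> ?f ` E"
          using space_subgroup_props(6)[OF K d'(2)] ke(1) \<open>k \<noteq> \<zero>\<close> l v by blast
        then show False using False by blast
      qed
      then have "x = e" using ke carr v by simp
      then show "x = \<zero>" using inj inj_on_mult_iff[OF K l E] ke(2) lx by blast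
    qed
    moreover have "inj_on ?f E" if "inj_on ?f (line_extension K v E)"
      using that sub by (rule inj_on_subset)
    ultimately show ?thesis using IH dim by (metis Suc_mono)
  qed
qed

text \<open>The rank is at most either dimension, so it is their minimum iff it attains one of them:
  the first by injectivity, the second by surjectivity.\<close>

lemma max_rank_mult_iff:
  assumes K: "subfield K R" and l: "l \<in> carrier R" and V: "finite_dimension K V" and W: "finite_dimension K W"
    and sub: "(\<otimes>) l ` V \<subseteq> W"
  shows "max_rank R K V W (\<lambda>x. l \<otimes> x) \<longleftrightarrow> inj_on ((\<otimes>) l) V \<or> (\<otimes>) l ` V = W"
proof -
  obtain v w where v: "dimension v K V" and w: "dimension w K W"
    using V W by (auto simp: finite_dimension_def)
  have dim: "dim K E = m" if "dimension m K E" for m E using dimI[OF K that] by (simp add: over_def)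
  obtain m where m: "dimension m K ((\<otimes>) l ` V)" "inj_on ((\<otimes>) l) V \<Longrightarrow> m = v"
      "\<not> inj_on ((\<otimes>) l) V \<Longrightarrow> m < v"
    using dimension_mult_image[OF K l v] by blast
  have mr: "max_rank R K V W (\<lambda>x. l \<otimes> x) \<longleftrightarrow> m = min v w"
    unfolding max_rank_def using dim[OF v] dim[OF w] dim[OF m(1)] by simp
  have "m \<le> w" "m = w \<longleftrightarrow> (\<otimes>) l ` V = W"
    using dimension_mono_eq[OF K m(1) w sub] dimension_is_inj[OF K m(1), of w] w by auto
  then show ?thesis unfolding mr using m(2,3) by (cases "inj_on ((\<otimes>) l) V") auto
qed

end

section \<open>The quotient ring, its scalars and its graded components\<close>

lemma mpoly_ring_simps [simp]:
  "mult (mpoly_ring V) = (*)" "one (mpoly_ring V) = 1" "zero (mpoly_ring V) = 0" "add (mpoly_ring V) = (+)"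
  by (simp_all add: mpoly_ring_def)

lemma mpoly_ring_carrier:
  "p \<in> carrier (mpoly_ring V) \<longleftrightarrow> (\<forall>m\<in>Poly_Mapping.keys p. Poly_Mapping.keys m \<subseteq> V)"
  by (simp add: mpoly_ring_def)

lemma piece_carrier: "p \<in> piece V D \<Longrightarrow> p \<in> carrier (mpoly_ring V)"
  unfolding mpoly_ring_carrier piece_def by blast

lemma piece_eq: "piece V (int d) = {p \<in> carrier (mpoly_ring V). homogeneous d p}"
  unfolding piece_def mpoly_ring_carrier homogeneous_def by auto

lemma mpoly_var_power: "mpoly_var i ^ s = monom_at i s 1"
  unfolding mpoly_var_def by (simp add: monom_at_power)

lemma mpoly_ring_minus:
  "p \<in> carrier (mpoly_ring V) \<Longrightarrow> a_inv (mpoly_ring V) p = - p"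
proof -
  interpret R: cring "mpoly_ring V :: 'a mpoly ring" by (rule mpoly_ring_cring)
  assume "p \<in> carrier (mpoly_ring V)"
  then show ?thesis by (intro R.minus_equality) (auto simp: mpoly_ring_carrier)
qed

lemma ideal_monomial_ideal:
  "ideal (monomial_ideal V b \<inter> carrier (mpoly_ring V)) (mpoly_ring V :: 'k::comm_ring_1 mpoly ring)"
proof -
  interpret R: cring "mpoly_ring V :: 'k mpoly ring" by (rule mpoly_ring_cring)
  show ?thesis
  proof (rule idealI[OF R.ring_axioms])
    show "subgroup (monomial_ideal V b \<inter> carrier (mpoly_ring V)) (add_monoid (mpoly_ring V :: 'k mpoly ring))"
    proof (rule R.add.subgroupI)
      fix p q :: "'k mpoly"
      assume p: "p \<in> monomial_ideal V b \<inter> carrier (mpoly_ring V)"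
      then show "\<ominus>\<^bsub>mpoly_ring V\<^esub> p \<in> monomial_ideal V b \<inter> carrier (mpoly_ring V)"
        using R.a_inv_closed[of p] by (auto simp: mpoly_ring_minus monomial_ideal_uminus)
      assume "q \<in> monomial_ideal V b \<inter> carrier (mpoly_ring V)"
      then show "p \<oplus>\<^bsub>mpoly_ring V\<^esub> q \<in> monomial_ideal V b \<inter> carrier (mpoly_ring V)"
        using p R.a_closed[of p q] by (auto simp: monomial_ideal_add)
    next
      show "monomial_ideal V b \<inter> carrier (mpoly_ring V :: 'k mpoly ring) \<noteq> {}"
        using R.zero_closed monomial_ideal_zero[of V b] by (metis IntI empty_iff mpoly_ring_simps(3))
    qed auto
    fix p q :: "'k mpoly"
    assume p: "p \<in> monomial_ideal V b \<inter> carrier (mpoly_ring V)" "q \<in> carrier (mpoly_ring V)"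
    then show "q \<otimes>\<^bsub>mpoly_ring V\<^esub> p \<in> monomial_ideal V b \<inter> carrier (mpoly_ring V)"
      "p \<otimes>\<^bsub>mpoly_ring V\<^esub> q \<in> monomial_ideal V b \<inter> carrier (mpoly_ring V)"
      using R.m_closed[of p q] R.m_closed[of q p]
      by (auto simp: monomial_ideal_mult monomial_ideal_mult_right)
  qed
qed

text \<open>\<open>monomial_ideal\<close> lives in the ring with all variables, hence the
  intersection. For the harder inclusion \<open>p\<close> is summed up from its monomials, each a
  multiple of one generator.\<close>

lemma mci_ideal_eq:
  "mci_ideal n a = monomial_ideal {1..n} (\<lambda>i. Suc (a i)) \<inter> carrier (mpoly_ring {1..n} :: 'k::comm_ring_1 mpoly ring)"
proof
  let ?V = "{1..n}" and ?R = "mpoly_ring {1..n} :: 'k mpoly ring"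
  interpret R: cring ?R by (rule mpoly_ring_cring)
  let ?G = "(\<lambda>i. mpoly_var i ^ (1 + a i)) ` {1..n} :: 'k mpoly set"
  have G: "?G \<subseteq> carrier ?R"
    unfolding mpoly_var_power mpoly_ring_carrier[abs_def] by (auto simp: mpoly_ring_carrier)
  have "?G \<subseteq> monomial_ideal ?V (\<lambda>i. Suc (a i))"
    unfolding mpoly_var_power by (auto intro!: monom_at_in_monomial_ideal)
  then show "mci_ideal n a \<subseteq> monomial_ideal ?V (\<lambda>i. Suc (a i)) \<inter> carrier ?R"
    unfolding mci_ideal_def using G by (intro R.genideal_minimal ideal_monomial_ideal) blast
  interpret I: ideal "mci_ideal n a" ?R
    unfolding mci_ideal_def by (rule R.genideal_ideal[OF G])
  show "monomial_ideal ?V (\<lambda>i. Suc (a i)) \<inter> carrier ?R \<subseteq> mci_ideal n a"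
  proof
    fix p assume p: "p \<in> monomial_ideal ?V (\<lambda>i. Suc (a i)) \<inter> carrier ?R"
    have "(\<Sum>m\<in>S. Poly_Mapping.single m (Poly_Mapping.lookup p m)) \<in> mci_ideal n a"
      if "S \<subseteq> Poly_Mapping.keys p" for S
    proof -
      have "finite S" using that by (rule finite_subset) simp
      then show ?thesis using that
      proof (induction S)
        case empty
        then show ?case using I.zero_closed by simp
      next
        case (insert m S)
        then have m: "m \<in> Poly_Mapping.keys p" by blast
        then obtain h where h: "h \<in> ?V" "Suc (a h) \<le> Poly_Mapping.lookup m h"
          using p unfolding monomial_ideal_def by blast
        have mV: "Poly_Mapping.keys m \<subseteq> ?V" using m p by (auto simp: mpoly_ring_carrier)
        define g where "g = monom_at h (1 + a h) (1::'k)"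
        define r where "r = Poly_Mapping.single (m - Poly_Mapping.single h (Suc (a h))) (Poly_Mapping.lookup p m)"
        have "g \<in> mci_ideal n a"
          using R.genideal_self[OF G] h(1) unfolding mci_ideal_def g_def mpoly_var_power[symmetric] by blast
        moreover have "r \<in> carrier ?R"
          unfolding r_def mpoly_ring_carrier using mV by (auto simp: in_keys_iff lookup_minus)
        ultimately have "g * r \<in> mci_ideal n a" using I.I_r_closed[of g r] by simp
        moreover have "g * r = Poly_Mapping.single m (Poly_Mapping.lookup p m)"
        proof -
          have "Poly_Mapping.single h (Suc (a h)) + (m - Poly_Mapping.single h (Suc (a h))) = m"
            using h(2) by (intro poly_mapping_eqI) (auto simp: lookup_add lookup_minus lookup_single when_def)
          then show ?thesis unfolding g_def r_def by (simp add: mult_single)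
        qed
        ultimately show ?case using insert I.a_closed by simp
      qed
    qed
    from this[OF order_refl] show "p \<in> mci_ideal n a" by (simp add: poly_mapping_sum_single)
  qed
qed

lemma ideal_mci_ideal: "ideal (mci_ideal n a) (mpoly_ring {1..n} :: 'k::comm_ring_1 mpoly ring)"
  unfolding mci_ideal_eq by (rule ideal_monomial_ideal)

lemma mci_ring_cring: "cring (mci_ring n a :: 'k::comm_ring_1 mpoly set ring)"
  unfolding mci_ring_def by (rule ideal.quotient_is_cring[OF ideal_mci_ideal mpoly_ring_cring])

lemma mci_class_hom:
  fixes p q :: "'k::comm_ring_1 mpoly"
  assumes "p \<in> carrier (mpoly_ring {1..n})" "q \<in> carrier (mpoly_ring {1..n})"
  shows "mci_class n a p \<oplus>\<^bsub>mci_ring n a\<^esub> mci_class n a q = mci_class n a (p + q)"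
    "mci_class n a p \<otimes>\<^bsub>mci_ring n a\<^esub> mci_class n a q = mci_class n a (p * q)"
  using ring_hom_add[OF ideal.rcos_ring_hom[OF ideal_mci_ideal[of n a]] assms]
    ring_hom_mult[OF ideal.rcos_ring_hom[OF ideal_mci_ideal[of n a]] assms]
  unfolding mci_class_def mci_ring_def by simp_all

lemma mci_class_one: "\<one>\<^bsub>mci_ring n a\<^esub> = mci_class n a (1 :: 'k::comm_ring_1 mpoly)"
  using ring_hom_one[OF ideal.rcos_ring_hom[OF ideal_mci_ideal[of n a]], symmetric]
  unfolding mci_class_def mci_ring_def by simp

lemma mci_ring_carrier:
  "carrier (mci_ring n a) = mci_class n a ` carrier (mpoly_ring {1..n} :: 'k::comm_ring_1 mpoly ring)"
  unfolding mci_ring_def FactRing_def A_RCOSETS_def' mci_class_def by auto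

lemma mem_mci_class: "p' \<in> mci_class n a p \<longleftrightarrow> (\<exists>j\<in>mci_ideal n a. p' = j + p)"
  unfolding mci_class_def a_r_coset_def' by auto

lemma mci_class_self: "(p :: 'k::comm_ring_1 mpoly) \<in> mci_class n a p"
  unfolding mem_mci_class mci_ideal_eq by (rule bexI[of _ 0]) (simp_all add: mpoly_ring_carrier)

lemma mci_class_eq_iff:
  fixes p q :: "'k::comm_ring_1 mpoly"
  assumes "p \<in> carrier (mpoly_ring {1..n})" "q \<in> carrier (mpoly_ring {1..n})"
  shows "mci_class n a p = mci_class n a q \<longleftrightarrow> p - q \<in> monomial_ideal {1..n} (\<lambda>i. Suc (a i))"
proof -
  interpret R: cring "mpoly_ring {1..n} :: 'k mpoly ring" by (rule mpoly_ring_cring)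
  interpret I: ideal "mci_ideal n a" "mpoly_ring {1..n} :: 'k mpoly ring" by (rule ideal_mci_ideal)
  have closed: "x + y \<in> mci_ideal n a" if "x \<in> mci_ideal n a" "y \<in> mci_ideal n a" for x y :: "'k mpoly"
    using I.a_closed that by simp
  have minus: "- x \<in> mci_ideal n a" if "x \<in> mci_ideal n a" for x :: "'k mpoly"
    using I.a_inv_closed[OF that] I.Icarr[OF that] by (simp add: mpoly_ring_minus)
  have "mci_class n a p = mci_class n a q \<longleftrightarrow> p - q \<in> mci_ideal n a"
  proof
    assume "mci_class n a p = mci_class n a q"
    moreover have "p \<in> mci_class n a p" by (rule mci_class_self)
    ultimately have "p \<in> mci_class n a q" by simp
    then show "p - q \<in> mci_ideal n a" unfolding mem_mci_class by auto
  next
    assume pq: "p - q \<in> mci_ideal n a"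
    show "mci_class n a p = mci_class n a q"
    proof (intro Set.set_eqI iffI)
      fix x assume "x \<in> mci_class n a p"
      then obtain j where "j \<in> mci_ideal n a" "x = j + p" unfolding mem_mci_class by blast
      then have "j + (p - q) \<in> mci_ideal n a" "x = (j + (p - q)) + q" using closed pq by auto
      then show "x \<in> mci_class n a q" unfolding mem_mci_class by blast
    next
      fix x assume "x \<in> mci_class n a q"
      then obtain j where "j \<in> mci_ideal n a" "x = j + q" unfolding mem_mci_class by blast
      then have "j + - (p - q) \<in> mci_ideal n a" "x = (j + - (p - q)) + p" using closed minus[OF pq] by auto
      then show "x \<in> mci_class n a p" unfolding mem_mci_class by blast
    qed
  qed
  moreover have "p - q \<in> carrier (mpoly_ring {1..n})"
  proof -
    have "- q \<in> carrier (mpoly_ring {1..n})" using assms(2) by (simp add: mpoly_ring_carrier)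
    then show ?thesis using R.a_closed[OF assms(1)] by force
  qed
  ultimately show ?thesis unfolding mci_ideal_eq by simp
qed

lemma mci_class_zero: "\<zero>\<^bsub>mci_ring n a\<^esub> = mci_class n a (0 :: 'k::comm_ring_1 mpoly)"
proof -
  interpret A: cring "mci_ring n a :: 'k mpoly set ring" by (rule mci_ring_cring)
  have z: "(0::'k mpoly) \<in> carrier (mpoly_ring {1..n})" by (simp add: mpoly_ring_carrier)
  have "mci_class n a (0 :: 'k mpoly) \<in> carrier (mci_ring n a)"
    unfolding mci_ring_carrier using z by blast
  moreover have "mci_class n a (0 :: 'k mpoly) \<oplus>\<^bsub>mci_ring n a\<^esub> mci_class n a 0 = mci_class n a 0"
    using mci_class_hom(1)[OF z z] by simp
  ultimately show ?thesis by (metis A.add.l_cancel_one)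
qed

lemma mpoly_const_carrier [simp]: "mpoly_const c \<in> carrier (mpoly_ring V)"
  unfolding mpoly_const_def mpoly_ring_carrier by simp

lemma mpoly_const_simps:
  "mpoly_const (c + d) = mpoly_const c + mpoly_const d"
  "mpoly_const (c * d) = mpoly_const c * mpoly_const d"
  "mpoly_const 0 = 0" "mpoly_const 1 = 1" "mpoly_const (- c) = - mpoly_const c"
  "mpoly_const (c - d) = mpoly_const c - mpoly_const d"
  unfolding mpoly_const_def by (simp_all add: single_add mult_single single_uminus single_diff)

text \<open>The powers in the ideal have positive exponents, so no nonzero constant lies in
  it.\<close>

lemma mci_class_const_inj:
  "mci_class n a (mpoly_const c) = mci_class n a (mpoly_const d) \<longleftrightarrow> c = d"
proof -
  have "mpoly_const u \<in> monomial_ideal {1..n} (\<lambda>i. Suc (a i)) \<longleftrightarrow> u = 0" for u :: 'a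
    unfolding monomial_ideal_def mpoly_const_def by auto
  then show ?thesis
    using mci_class_eq_iff[of "mpoly_const c" n "mpoly_const d" a] mpoly_const_simps(6)[of c d, symmetric] by simp
qed

lemma mci_class_const_eq_zero:
  "mci_class n a (mpoly_const c) = \<zero>\<^bsub>mci_ring n a\<^esub> \<longleftrightarrow> c = 0"
  unfolding mci_class_zero using mci_class_const_inj[of n a c 0] by (simp add: mpoly_const_simps)

lemma subfield_mci_scalars: "subfield (mci_scalars n a) (mci_ring n a :: 'k::field mpoly set ring)"
proof -
  interpret A: cring "mci_ring n a :: 'k mpoly set ring" by (rule mci_ring_cring)
  let ?A = "mci_ring n a :: 'k mpoly set ring" and ?k = "\<lambda>c::'k. mci_class n a (mpoly_const c)"
  have carr: "mci_scalars n a \<subseteq> carrier ?A"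
    unfolding mci_scalars_def mci_ring_carrier by auto
  have add: "?k c \<oplus>\<^bsub>?A\<^esub> ?k d = ?k (c + d)" and mult: "?k c \<otimes>\<^bsub>?A\<^esub> ?k d = ?k (c * d)" for c d
    by (simp_all add: mci_class_hom mpoly_const_simps)
  have zero: "\<zero>\<^bsub>?A\<^esub> = ?k 0" and one: "\<one>\<^bsub>?A\<^esub> = ?k 1"
    by (simp_all add: mci_class_zero mci_class_one mpoly_const_simps)
  have neg: "\<ominus>\<^bsub>?A\<^esub> ?k c = ?k (- c)" for c
    by (rule A.minus_equality) (use carr in \<open>auto simp: add zero mci_scalars_def\<close>)
  have sub: "subring (mci_scalars n a) ?A"
  proof (rule A.subringI[OF carr])
    show "\<one>\<^bsub>?A\<^esub> \<in> mci_scalars n a" unfolding one mci_scalars_def by blast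
    show "\<ominus>\<^bsub>?A\<^esub> h \<in> mci_scalars n a" if "h \<in> mci_scalars n a" for h
      using that neg unfolding mci_scalars_def by force
    show "h1 \<otimes>\<^bsub>?A\<^esub> h2 \<in> mci_scalars n a" if "h1 \<in> mci_scalars n a" "h2 \<in> mci_scalars n a" for h1 h2
      using that mult unfolding mci_scalars_def by force
    show "h1 \<oplus>\<^bsub>?A\<^esub> h2 \<in> mci_scalars n a" if "h1 \<in> mci_scalars n a" "h2 \<in> mci_scalars n a" for h1 h2
      using that add unfolding mci_scalars_def by force
  qed
  have "subcring (mci_scalars n a) ?A"
    by (rule A.subcringI'[OF sub])
  then have "cring (?A \<lparr> carrier := mci_scalars n a \<rparr>)"
    unfolding A.subcring_iff[OF carr] .
  then have "field (?A \<lparr> carrier := mci_scalars n a \<rparr>)"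
  proof (rule cring.cring_fieldI2)
    show "\<zero>\<^bsub>?A\<lparr>carrier := mci_scalars n a\<rparr>\<^esub> \<noteq> \<one>\<^bsub>?A\<lparr>carrier := mci_scalars n a\<rparr>\<^esub>"
      by (simp add: zero one mci_class_const_inj)
  next
    fix u assume u: "u \<in> carrier (?A\<lparr>carrier := mci_scalars n a\<rparr>)" "u \<noteq> \<zero>\<^bsub>?A\<lparr>carrier := mci_scalars n a\<rparr>\<^esub>"
    then obtain c where c: "u = ?k c" "c \<noteq> 0" by (auto simp: zero mci_scalars_def)
    then have "u \<otimes>\<^bsub>?A\<^esub> ?k (inverse c) = \<one>\<^bsub>?A\<^esub>" by (simp add: mult one)
    then show "\<exists>b\<in>carrier (?A\<lparr>carrier := mci_scalars n a\<rparr>).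
        u \<otimes>\<^bsub>?A\<lparr>carrier := mci_scalars n a\<rparr>\<^esub> b = \<one>\<^bsub>?A\<lparr>carrier := mci_scalars n a\<rparr>\<^esub>"
      by (auto simp: mci_scalars_def)
  qed
  then show ?thesis by (rule A.subfield_iff(1)) (rule carr)
qed

lemma mci_component_eq: "mci_component n a d = mci_class n a ` piece {1..n} (int d)"
  unfolding mci_component_def piece_eq ..

text \<open>The monomials of degree \<open>d\<close> form a finite spanning set. They are added one
  at a time, and each leaves the span unchanged or enlarges it by one dimension.\<close>

lemma finite_dimension_mci_component:
  "ring.finite_dimension (mci_ring n a :: 'k::field mpoly set ring) (mci_scalars n a) (mci_component n a d)"
proof -
  interpret A: cring "mci_ring n a :: 'k mpoly set ring" by (rule mci_ring_cring)
  let ?A = "mci_ring n a :: 'k mpoly set ring" and ?R = "mpoly_ring {1..n} :: 'k mpoly ring"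
  define cls where "cls = (mci_class n a :: 'k mpoly \<Rightarrow> _)"
  define F where "F S = {p :: 'k mpoly. Poly_Mapping.keys p \<subseteq> S}" for S
  define M where "M = {m. Poly_Mapping.keys m \<subseteq> {1..n} \<and> monomial_degree m = d}"
  have FR: "F S \<subseteq> carrier ?R" if "S \<subseteq> M" for S
  proof
    fix p assume "p \<in> F S"
    then have "\<forall>m\<in>Poly_Mapping.keys p. Poly_Mapping.keys m \<subseteq> {1..n}"
      using that unfolding F_def M_def by blast
    then show "p \<in> carrier ?R" by (simp only: mpoly_ring_carrier)
  qed
  have "A.finite_dimension (mci_scalars n a) (cls ` F S)" if "finite S" "S \<subseteq> M" for S
    using that
  proof (induction S)
    case empty
    have "F {} = {0}" unfolding F_def by auto
    then show ?case
      using A.dimension.zero_dim[of "mci_scalars n a"] A.finite_dimensionI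
      by (simp add: cls_def mci_class_zero)
  next
    case (insert m S)
    define v where "v = Poly_Mapping.single m (1::'k)"
    have FS: "F S \<subseteq> carrier ?R" "F (insert m S) \<subseteq> carrier ?R" using FR insert.prems by auto
    have v: "v \<in> carrier ?R" using insert.prems unfolding v_def mpoly_ring_carrier M_def by simp
    have cv: "mpoly_const u * v = Poly_Mapping.single m u" for u
      unfolding v_def mpoly_const_def by (simp add: mult_single)
    have smult: "mci_class n a (mpoly_const u) \<otimes>\<^bsub>?A\<^esub> cls v = cls (mpoly_const u * v)" for u
      unfolding cls_def using v by (simp add: mci_class_hom)
    have cvR: "mpoly_const u * v \<in> carrier ?R" for u
      using insert.prems unfolding cv mpoly_ring_carrier M_def by simp
    have "cls ` F (insert m S) = A.line_extension (mci_scalars n a) (cls v) (cls ` F S)"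
    proof (intro Set.set_eqI iffI)
      fix x assume "x \<in> cls ` F (insert m S)"
      then obtain p where p: "p \<in> F (insert m S)" "x = cls p" by blast
      define q where "q = p - Poly_Mapping.single m (Poly_Mapping.lookup p m)"
      have q: "q \<in> F S" unfolding q_def F_def
        using p(1) unfolding F_def by (auto simp: in_keys_iff lookup_minus lookup_single when_def split: if_splits)
      have "p = mpoly_const (Poly_Mapping.lookup p m) * v + q" unfolding cv q_def by simp
      then have "x = mci_class n a (mpoly_const (Poly_Mapping.lookup p m)) \<otimes>\<^bsub>?A\<^esub> cls v \<oplus>\<^bsub>?A\<^esub> cls q"
        unfolding smult using p(2) q FS(1) cvR mci_class_hom(1)[OF cvR, of q a] unfolding cls_def by auto
      then show "x \<in> A.line_extension (mci_scalars n a) (cls v) (cls ` F S)"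
        unfolding A.line_extension_mem_iff mci_scalars_def using q by blast
    next
      fix x assume "x \<in> A.line_extension (mci_scalars n a) (cls v) (cls ` F S)"
      then obtain u q where uq: "q \<in> F S" "x = mci_class n a (mpoly_const u) \<otimes>\<^bsub>?A\<^esub> cls v \<oplus>\<^bsub>?A\<^esub> cls q"
        unfolding A.line_extension_mem_iff mci_scalars_def by blast
      then have "x = cls (mpoly_const u * v + q)"
        unfolding uq(2) smult unfolding cls_def using FS(1) by (intro mci_class_hom(1)[OF cvR]) blast
      moreover have "mpoly_const u * v + q \<in> F (insert m S)"
        using uq(1) Poly_Mapping.keys_add[of "Poly_Mapping.single m u" q]
        unfolding cv F_def by (auto split: if_splits)
      ultimately show "x \<in> cls ` F (insert m S)" by blast
    qed
    moreover have "cls v \<in> carrier ?A" unfolding cls_def mci_ring_carrier using v by blast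
    moreover obtain N where N: "A.dimension N (mci_scalars n a) (cls ` F S)"
      using insert unfolding A.finite_dimension_def by blast
    ultimately show ?case
    proof (cases "cls v \<in> cls ` F S")
      case True
      have "A.line_extension (mci_scalars n a) (cls v) (cls ` F S) \<subseteq> cls ` F S"
        using A.space_subgroup_props(3,5)[OF subfield_mci_scalars N] True
        by (auto simp: A.line_extension_mem_iff)
      moreover have "cls ` F S \<subseteq> cls ` F (insert m S)" unfolding F_def by blast
      ultimately have "cls ` F (insert m S) = cls ` F S"
        using \<open>cls ` F (insert m S) = _\<close> by blast
      then show ?thesis using N A.finite_dimensionI by metis
    next
      case False
      then show ?thesis
        using A.dimension.Suc_dim[OF \<open>cls v \<in> carrier ?A\<close> _ N] \<open>cls ` F (insert m S) = _\<close>
          A.finite_dimensionI by metis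
    qed
  qed
  moreover have "finite M" unfolding M_def by (rule finite_monomials_of_degree) simp
  moreover have "F M = piece {1..n} (int d)" unfolding F_def M_def piece_def by auto
  ultimately show ?thesis unfolding mci_component_eq cls_def by (metis order_refl)
qed

lemma mci_max_rank_iff:
  fixes l :: "'k::field mpoly"
  assumes l: "l \<in> piece {1..n} 1"
  shows "max_rank (mci_ring n a) (mci_scalars n a) (mci_component n a d) (mci_component n a (d + 1))
      (\<lambda>x. mci_class n a l \<otimes>\<^bsub>mci_ring n a\<^esub> x) \<longleftrightarrow>
    mult_injective {1..n} a l d \<or> mult_surjective {1..n} a l d"
proof -
  interpret A: cring "mci_ring n a :: 'k mpoly set ring" by (rule mci_ring_cring)
  let ?A = "mci_ring n a :: 'k mpoly set ring" and ?f = "\<lambda>x. mci_class n a l \<otimes>\<^bsub>mci_ring n a\<^esub> x"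
  have lR: "l \<in> carrier (mpoly_ring {1..n})" by (rule piece_carrier[OF l])
  have lA: "mci_class n a l \<in> carrier ?A" unfolding mci_ring_carrier using lR by blast
  have f: "?f (mci_class n a p) = mci_class n a (l * p)" if "p \<in> piece {1..n} (int d)" for p
    using mci_class_hom(2)[OF lR piece_carrier[OF that]] .
  have lp: "l * p \<in> piece {1..n} (int d + 1)" if "p \<in> piece {1..n} (int d)" for p
    by (rule piece_mult'[OF l that]) simp
  have G1: "mci_component n a (d + 1) = mci_class n a ` piece {1..n} (int d + 1)"
    unfolding mci_component_eq by (simp add: add.commute)
  have sub: "?f ` mci_component n a d \<subseteq> mci_component n a (d + 1)"
    unfolding G1 unfolding mci_component_eq using f lp by auto
  obtain N where N: "A.dimension N (mci_scalars n a) (mci_component n a d)"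
    using finite_dimension_mci_component unfolding A.finite_dimension_def by blast
  have zero: "mci_class n a p = \<zero>\<^bsub>?A\<^esub> \<longleftrightarrow> p \<in> monomial_ideal {1..n} (\<lambda>i. Suc (a i))"
    if "p \<in> piece {1..n} D" for p :: "'k mpoly" and D
    unfolding mci_class_zero using mci_class_eq_iff[OF piece_carrier[OF that] piece_carrier[OF piece_zero[of _ D]]]
    by simp
  have "inj_on ?f (mci_component n a d) \<longleftrightarrow> mult_injective {1..n} a l d"
    unfolding A.inj_on_mult_iff[OF subfield_mci_scalars lA N] mult_injective_def
    unfolding mci_component_eq using f zero zero[OF lp] by (auto simp: ball_simps)
  moreover have "?f ` mci_component n a d = mci_component n a (d + 1) \<longleftrightarrow> mult_surjective {1..n} a l d"
  proof -
    have im: "?f ` mci_component n a d = (\<lambda>p. mci_class n a (l * p)) ` piece {1..n} (int d)"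
      unfolding mci_component_eq image_image by (rule image_cong[OF refl f])
    have "?f ` mci_component n a d = mci_component n a (d + 1) \<longleftrightarrow>
        mci_component n a (d + 1) \<subseteq> ?f ` mci_component n a d"
      using sub by blast
    also have "\<dots> \<longleftrightarrow>
        (\<forall>y\<in>piece {1..n} (int d + 1). \<exists>p\<in>piece {1..n} (int d). mci_class n a y = mci_class n a (l * p))"
      unfolding im G1 by blast
    also have "\<dots> \<longleftrightarrow> mult_surjective {1..n} a l d"
      unfolding mult_surjective_def
      using mci_class_eq_iff[OF piece_carrier piece_carrier[OF lp]] by blast
    finally show ?thesis .
  qed
  ultimately show ?thesis
    using A.max_rank_mult_iff[OF subfield_mci_scalars lA finite_dimension_mci_component
        finite_dimension_mci_component sub] by simp
qed

lemma mci_max_rank_linear_form_iff: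
  fixes c :: "nat \<Rightarrow> 'k::field"
  shows "(\<forall>d. max_rank (mci_ring n a) (mci_scalars n a) (mci_component n a d) (mci_component n a (d + 1))
      (\<lambda>x. mci_class n a (linear_form {1..n} c) \<otimes>\<^bsub>mci_ring n a\<^esub> x)) \<longleftrightarrow>
    injective_below_middle {1..n} c (\<lambda>i. Suc (a i))"
  unfolding mci_max_rank_iff[OF piece_linear_form]
  using mult_injective_or_surjective_imp_injective_below_middle[of "{1..n}" a c]
    injective_below_middle_imp_mult_injective_or_surjective[of "{1..n}" c a] by blast

section \<open>Genericity\<close>

lemma linear_form_of_piece:
  fixes p :: "'k::comm_ring_1 mpoly"
  assumes fin: "finite V" and p: "p \<in> piece V 1"
  shows "p = linear_form V (\<lambda>i. Poly_Mapping.lookup p (Poly_Mapping.single i 1))"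
proof -
  have deg1: "\<exists>i\<in>V. m = Poly_Mapping.single i 1" if m: "m \<in> Poly_Mapping.keys p" for m
  proof -
    have d: "monomial_degree m = 1" "Poly_Mapping.keys m \<subseteq> V" using m p unfolding piece_def by auto
    then have "m \<noteq> 0" by auto
    then obtain i where i: "Poly_Mapping.lookup m i \<noteq> 0" by (metis poly_mapping_eqI lookup_zero)
    have eq: "m = Poly_Mapping.single i 1 + (m - Poly_Mapping.single i 1)"
      using i by (intro poly_mapping_eqI) (auto simp: lookup_add lookup_minus lookup_single when_def)
    have "monomial_degree (m - Poly_Mapping.single i 1) = 0"
    proof -
      have "monomial_degree m = monomial_degree (Poly_Mapping.single i 1) + monomial_degree (m - Poly_Mapping.single i 1)"
        using monomial_degree_add[of "Poly_Mapping.single i 1" "m - Poly_Mapping.single i 1"] eq by metis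
      then show ?thesis using d(1) by simp
    qed
    then have "m - Poly_Mapping.single i 1 = 0"
      using lookup_le_monomial_degree[of "m - Poly_Mapping.single i 1"] by (intro poly_mapping_eqI) simp
    then have "m = Poly_Mapping.single i 1" using eq by simp
    moreover have "i \<in> V" using i d(2) by (auto simp: in_keys_iff)
    ultimately show ?thesis by blast
  qed
  let ?s = "\<lambda>i::nat. Poly_Mapping.single i (1::nat)"
  have inj: "inj_on ?s V" by (rule inj_onI) (metis keys_single singleton_inject zero_neq_one)
  have "p = (\<Sum>m\<in>Poly_Mapping.keys p. Poly_Mapping.single m (Poly_Mapping.lookup p m))"
    by (rule poly_mapping_sum_single[symmetric])
  also have "\<dots> = (\<Sum>m\<in>?s ` V. Poly_Mapping.single m (Poly_Mapping.lookup p m))"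
    by (rule sum.mono_neutral_left) (use fin deg1 in \<open>auto simp: in_keys_iff\<close>)
  also have "\<dots> = (\<Sum>i\<in>V. Poly_Mapping.single (?s i) (Poly_Mapping.lookup p (?s i)))"
    by (rule sum.reindex[OF inj, unfolded comp_def])
  finally show ?thesis unfolding linear_form_def .
qed

lemma lookup_linear_form:
  "finite V \<Longrightarrow> i \<in> V \<Longrightarrow> Poly_Mapping.lookup (linear_form V c) (Poly_Mapping.single i 1) = c i"
  unfolding linear_form_def lookup_sum lookup_single
  by (subst sum.cong[OF refl, of _ _ "\<lambda>j. if j = i then c i else 0"])
    (auto simp: when_def dest: arg_cong[of _ _ Poly_Mapping.keys])

lemma linear_form_affine:
  "linear_form V (\<lambda>i. c i + t * e i) = linear_form V c + mpoly_const t * linear_form V e"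
  unfolding linear_form_def mpoly_const_def
  by (simp add: sum_distrib_left mult_single single_add sum.distrib)

lemma infinite_UNIV_alg_closed: "infinite (UNIV :: 'k::alg_closed_field set)"
proof
  assume fin: "finite (UNIV :: 'k set)"
  define p :: "'k poly" where "p = (\<Prod>x\<in>UNIV. [:- x, 1:]) + 1"
  have "degree (\<Prod>x\<in>(UNIV :: 'k set). [:- x, 1:]) = card (UNIV :: 'k set)"
    by (subst degree_prod_eq_sum_degree) auto
  moreover have "card (UNIV :: 'k set) > 0" using fin by (simp add: card_gt_0_iff)
  ultimately have "degree p > 0" unfolding p_def by (subst degree_add_eq_left) auto
  then obtain x where "poly p x = 0" using alg_closed_imp_poly_has_root by blast
  moreover have "poly p x = 1" unfolding p_def using fin by (simp add: poly_prod prod_zero_iff)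
  ultimately show False by simp
qed

lemma mci_component_one:
  "mci_component n a 1 = range (\<lambda>c. mci_class n a (linear_form {1..n} (c :: nat \<Rightarrow> 'k::field)))"
proof
  have "piece {1..n} 1 \<subseteq> range (linear_form {1..n} :: (nat \<Rightarrow> 'k) \<Rightarrow> _)"
    using linear_form_of_piece[of "{1..n}"] by blast
  then show "mci_component n a 1 \<subseteq> range (\<lambda>c. mci_class n a (linear_form {1..n} (c :: nat \<Rightarrow> 'k)))"
    unfolding mci_component_eq by auto
  show "range (\<lambda>c. mci_class n a (linear_form {1..n} (c :: nat \<Rightarrow> 'k))) \<subseteq> mci_component n a 1"
    unfolding mci_component_eq using piece_linear_form by auto
qed

lemma mci_class_affine:
  fixes c e :: "nat \<Rightarrow> 'k::field"
  shows "mci_class n a (linear_form {1..n} (\<lambda>i. c i + t * e i)) =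
    mci_class n a (linear_form {1..n} c) \<oplus>\<^bsub>mci_ring n a\<^esub>
      (mci_class n a (mpoly_const t) \<otimes>\<^bsub>mci_ring n a\<^esub> mci_class n a (linear_form {1..n} e))"
proof -
  have l: "linear_form {1..n} u \<in> carrier (mpoly_ring {1..n})" for u :: "nat \<Rightarrow> 'k"
    by (rule piece_carrier[OF piece_linear_form])
  have "mpoly_const t * linear_form {1..n} e \<in> carrier (mpoly_ring {1..n})"
    using cring.cring_simprules(5)[OF mpoly_ring_cring mpoly_const_carrier l] by simp
  then show ?thesis
    unfolding linear_form_affine mci_class_hom(2)[OF mpoly_const_carrier l]
    by (rule mci_class_hom(1)[OF l, symmetric])
qed

text \<open>This reduces the intersection of open sets to counting roots of a univariate polynomial
  in \<open>t\<close>. Along the line a linear functional contributes a polynomial of degree at most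
  one.\<close>

lemma polynomial_function_on_line:
  fixes c e :: "nat \<Rightarrow> 'k::field"
  assumes "F \<in> polynomial_functions (mci_ring n a) (mci_scalars n a) (mci_component n a 1)"
  shows "\<exists>f. \<forall>t. F (mci_class n a (linear_form {1..n} (\<lambda>i. c i + t * e i))) = mci_class n a (mpoly_const (poly f t))"
  using assms
proof induction
  case (const x)
  then obtain u where "x = mci_class n a (mpoly_const u)" unfolding mci_scalars_def by blast
  then show ?case by (intro exI[of _ "[:u:]"]) simp
next
  case (linear \<phi>)
  let ?l = "\<lambda>c. mci_class n a (linear_form {1..n} (c :: nat \<Rightarrow> 'k))"
  have in1: "?l u \<in> mci_component n a 1" for u unfolding mci_component_one by blast
  have lin1: "\<phi> v \<in> mci_scalars n a" if "v \<in> mci_component n a 1" for v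
    using linear that unfolding linear_functional_def by blast
  have lin2: "\<phi> (v \<oplus>\<^bsub>mci_ring n a\<^esub> w) = \<phi> v \<oplus>\<^bsub>mci_ring n a\<^esub> \<phi> w"
    if "v \<in> mci_component n a 1" "w \<in> mci_component n a 1" for v w
    using linear that unfolding linear_functional_def by blast
  have lin3: "\<phi> (k \<otimes>\<^bsub>mci_ring n a\<^esub> v) = k \<otimes>\<^bsub>mci_ring n a\<^esub> \<phi> v"
    if "k \<in> mci_scalars n a" "v \<in> mci_component n a 1" for v k
    using linear that unfolding linear_functional_def by blast
  obtain u v where uv: "\<phi> (?l c) = mci_class n a (mpoly_const u)" "\<phi> (?l e) = mci_class n a (mpoly_const v)"
    using lin1[OF in1, of c] lin1[OF in1, of e] unfolding mci_scalars_def by blast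
  have "\<phi> (?l (\<lambda>i. c i + t * e i)) = mci_class n a (mpoly_const (poly [:u, v:] t))" for t
  proof -
    have k: "mci_class n a (mpoly_const t) \<in> mci_scalars n a" unfolding mci_scalars_def by blast
    \<comment> \<open>The summand 0 brings the scaled form into the shape of
      \<open>linear_form_affine\<close>.\<close>
    have te: "mci_class n a (mpoly_const t) \<otimes>\<^bsub>mci_ring n a\<^esub> ?l e = ?l (\<lambda>i. 0 + t * e i)"
    proof -
      have "mpoly_const t * linear_form {1..n} e = linear_form {1..n} (\<lambda>i. 0 + t * e i)"
        unfolding linear_form_affine by (simp add: linear_form_def)
      then show ?thesis
        by (simp only: mci_class_hom(2)[OF mpoly_const_carrier piece_carrier[OF piece_linear_form]])
    qed
    have "\<phi> (?l (\<lambda>i. c i + t * e i)) =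
        \<phi> (?l c \<oplus>\<^bsub>mci_ring n a\<^esub> (mci_class n a (mpoly_const t) \<otimes>\<^bsub>mci_ring n a\<^esub> ?l e))"
      by (simp only: mci_class_affine)
    also have "\<dots> = \<phi> (?l c) \<oplus>\<^bsub>mci_ring n a\<^esub> \<phi> (mci_class n a (mpoly_const t) \<otimes>\<^bsub>mci_ring n a\<^esub> ?l e)"
      unfolding te by (rule lin2[OF in1 in1])
    also have "\<phi> (mci_class n a (mpoly_const t) \<otimes>\<^bsub>mci_ring n a\<^esub> ?l e) = mci_class n a (mpoly_const t) \<otimes>\<^bsub>mci_ring n a\<^esub> \<phi> (?l e)"
      by (rule lin3[OF k in1])
    finally have "\<phi> (?l (\<lambda>i. c i + t * e i)) =
        \<phi> (?l c) \<oplus>\<^bsub>mci_ring n a\<^esub> (mci_class n a (mpoly_const t) \<otimes>\<^bsub>mci_ring n a\<^esub> \<phi> (?l e))" .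
    then show ?thesis unfolding uv by (simp add: mci_class_hom mpoly_const_simps[symmetric])
  qed
  then show ?case by blast
next
  case (add F G)
  then obtain f g where "\<forall>t. F (mci_class n a (linear_form {1..n} (\<lambda>i. c i + t * e i))) = mci_class n a (mpoly_const (poly f t))"
    "\<forall>t. G (mci_class n a (linear_form {1..n} (\<lambda>i. c i + t * e i))) = mci_class n a (mpoly_const (poly g t))" by blast
  then show ?case by (intro exI[of _ "f + g"]) (simp add: mci_class_hom mpoly_const_simps)
next
  case (mult F G)
  then obtain f g where "\<forall>t. F (mci_class n a (linear_form {1..n} (\<lambda>i. c i + t * e i))) = mci_class n a (mpoly_const (poly f t))"
    "\<forall>t. G (mci_class n a (linear_form {1..n} (\<lambda>i. c i + t * e i))) = mci_class n a (mpoly_const (poly g t))" by blast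
  then show ?case by (intro exI[of _ "f * g"]) (simp add: mci_class_hom mpoly_const_simps)
qed

text \<open>With \<open>a i \<noteq> 0\<close> the monomial T_i occurs in no element of the ideal,
  so its coefficient is the same for all representatives, in particular for the one picked by
  \<open>SOME\<close>. For \<open>a i = 0\<close> the variable is zero in the quotient.\<close>

lemma coordinate_linear_functional:
  assumes i: "i \<in> {1..n}" "a i \<noteq> 0"
  obtains \<phi> where "linear_functional (mci_ring n a) (mci_scalars n a) (mci_component n a 1) \<phi>"
    "\<And>c :: nat \<Rightarrow> 'k::field. \<phi> (mci_class n a (linear_form {1..n} c)) = mci_class n a (mpoly_const (c i))"
proof -
  let ?e = "Poly_Mapping.single i (1::nat)"
  define \<phi> where "\<phi> v = mci_class n a (mpoly_const (Poly_Mapping.lookup (SOME p :: 'k mpoly. p \<in> v) ?e))" for v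
  have \<phi>: "\<phi> (mci_class n a p) = mci_class n a (mpoly_const (Poly_Mapping.lookup p ?e))" for p :: "'k mpoly"
  proof -
    have "(SOME p'. p' \<in> mci_class n a p) \<in> mci_class n a p" by (rule someI) (rule mci_class_self)
    then obtain j where j: "j \<in> mci_ideal n a" "(SOME p'. p' \<in> mci_class n a p) = j + p"
      unfolding mem_mci_class by blast
    have "Poly_Mapping.lookup j ?e = 0"
    proof (rule ccontr)
      assume "Poly_Mapping.lookup j ?e \<noteq> 0"
      then have "?e \<in> Poly_Mapping.keys j" by (simp add: in_keys_iff)
      then obtain h where "h \<in> {1..n}" "Suc (a h) \<le> Poly_Mapping.lookup ?e h"
        using j(1) unfolding mci_ideal_eq monomial_ideal_def by blast
      then show False using i(2) by (auto simp: lookup_single when_def split: if_splits)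
    qed
    then show ?thesis unfolding \<phi>_def j(2) by (simp add: lookup_add)
  qed
  have "linear_functional (mci_ring n a) (mci_scalars n a) (mci_component n a 1) \<phi>"
    unfolding linear_functional_def
  proof (intro conjI ballI)
    show "\<phi> \<in> mci_component n a 1 \<rightarrow> mci_scalars n a"
      unfolding \<phi>_def mci_scalars_def by auto
    fix v :: "'k mpoly set" assume v: "v \<in> mci_component n a 1"
    then obtain p where p: "v = mci_class n a p" "p \<in> piece {1..n} 1" unfolding mci_component_eq by auto
    show "\<phi> (v \<oplus>\<^bsub>mci_ring n a\<^esub> w) = \<phi> v \<oplus>\<^bsub>mci_ring n a\<^esub> \<phi> w" if w: "w \<in> mci_component n a 1" for w
    proof -
      obtain q where q: "w = mci_class n a q" "q \<in> piece {1..n} 1" using w unfolding mci_component_eq by auto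
      show ?thesis unfolding p(1) q(1) mci_class_hom(1)[OF piece_carrier[OF p(2)] piece_carrier[OF q(2)]] \<phi>
        by (simp add: lookup_add mci_class_hom mpoly_const_simps)
    qed
    fix k :: "'k mpoly set" assume "k \<in> mci_scalars n a"
    then obtain u where u: "k = mci_class n a (mpoly_const u)" unfolding mci_scalars_def by blast
    have "Poly_Mapping.lookup (mpoly_const u * p) (0 + ?e) = u * Poly_Mapping.lookup p ?e"
      unfolding mpoly_const_def by (rule lookup_single_mult)
    then show "\<phi> (k \<otimes>\<^bsub>mci_ring n a\<^esub> v) = k \<otimes>\<^bsub>mci_ring n a\<^esub> \<phi> v"
      unfolding u p(1) mci_class_hom(2)[OF mpoly_const_carrier piece_carrier[OF p(2)]] \<phi>
      by (simp add: mci_class_hom mpoly_const_simps)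
  qed
  moreover have "\<phi> (mci_class n a (linear_form {1..n} c)) = mci_class n a (mpoly_const (c i))" for c :: "nat \<Rightarrow> 'k"
    unfolding \<phi> using lookup_linear_form[of "{1..n}" i c] i(1) by simp
  ultimately show thesis using that by blast
qed

lemma coordinate_product_polynomial_function:
  assumes "finite T" "\<And>i. i \<in> T \<Longrightarrow> i \<in> {1..n} \<and> a i \<noteq> 0"
  shows "\<exists>F \<in> polynomial_functions (mci_ring n a) (mci_scalars n a) (mci_component n a 1).
    \<forall>c :: nat \<Rightarrow> 'k::field. F (mci_class n a (linear_form {1..n} c)) = mci_class n a (mpoly_const (\<Prod>i\<in>T. c i))"
  using assms
proof (induction T)
  case empty
  then show ?case
    by (intro bexI[OF _ polynomial_functions.const[of "mci_class n a (mpoly_const 1)"]])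
      (auto simp: mci_scalars_def)
next
  case (insert i T)
  then obtain F where F: "F \<in> polynomial_functions (mci_ring n a) (mci_scalars n a) (mci_component n a 1)"
    "\<forall>c :: nat \<Rightarrow> 'k. F (mci_class n a (linear_form {1..n} c)) = mci_class n a (mpoly_const (\<Prod>i\<in>T. c i))"
    by blast
  obtain \<phi> where "linear_functional (mci_ring n a) (mci_scalars n a) (mci_component n a 1) \<phi>"
    "\<And>c :: nat \<Rightarrow> 'k. \<phi> (mci_class n a (linear_form {1..n} c)) = mci_class n a (mpoly_const (c i))"
    using coordinate_linear_functional[of i n a] insert.prems by blast
  then show ?case
    using insert.hyps F
    by (intro bexI[OF _ polynomial_functions.mult[OF polynomial_functions.linear F(1)]])
      (auto simp: mci_class_hom mpoly_const_simps)
qed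

text \<open>
  The torus of linear forms with nonzero coefficients is a nonempty open set, which meets every other
  nonempty open set; on it the rank conditions do not depend on the linear form.
\<close>

lemma weak_lefschetz_iff_nim_condition:
  assumes two: "(2::'k::alg_closed_field) = 0"
  shows "weak_lefschetz (mci_ring n a :: 'k mpoly set ring) (mci_scalars n a) (mci_component n a)
    \<longleftrightarrow> nim_condition {1..n} a"
proof
  let ?A = "mci_ring n a :: 'k mpoly set ring" and ?K = "mci_scalars n a :: 'k mpoly set set"
    and ?l = "\<lambda>c. mci_class n a (linear_form {1..n} (c :: nat \<Rightarrow> 'k))"
  define P where "P l \<longleftrightarrow> (\<forall>d. max_rank ?A ?K (mci_component n a d) (mci_component n a (d + 1)) (\<lambda>x. l \<otimes>\<^bsub>?A\<^esub> x))" for l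
  have torus: "P (?l c) \<longleftrightarrow> nim_condition {1..n} a" if "\<And>i. i \<in> {1..n} \<Longrightarrow> c i \<noteq> 0" for c
    unfolding P_def mci_max_rank_linear_form_iff
    by (rule injective_below_middle_iff_nim_condition[OF two]) (use that in auto)
  have wl: "weak_lefschetz ?A ?K (mci_component n a) \<longleftrightarrow> generically ?A ?K (mci_component n a 1) P"
    unfolding weak_lefschetz_def P_def ..
  show "nim_condition {1..n} a" if "weak_lefschetz ?A ?K (mci_component n a)"
  proof -
    from that obtain U S where U: "U \<subseteq> mci_component n a 1" "U \<noteq> {}" "\<forall>v\<in>U. P v"
      and S: "S \<subseteq> polynomial_functions ?A ?K (mci_component n a 1)"
        "mci_component n a 1 - U = {v \<in> mci_component n a 1. \<forall>F\<in>S. F v = \<zero>\<^bsub>?A\<^esub>}"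
      unfolding wl generically_def zariski_closed_def by blast
    obtain c0 where c0: "?l c0 \<in> U" using U(1,2) unfolding mci_component_one by blast
    then obtain F where F: "F \<in> S" "F (?l c0) \<noteq> \<zero>\<^bsub>?A\<^esub>" using S(2) U(1) by blast
    \<comment> \<open>The line runs from \<open>c0\<close> at t = 0, where \<open>F\<close> does not
      vanish, to the all-ones form at t = 1, where no coordinate vanishes; so neither factor of
      \<open>f * g\<close> is zero.\<close>
    define c where "c t = (\<lambda>i. c0 i + t * (1 - c0 i))" for t
    obtain f where f: "\<And>t. F (?l (c t)) = mci_class n a (mpoly_const (poly f t))"
      using polynomial_function_on_line[of F n a c0 "\<lambda>i. 1 - c0 i"] F(1) S(1) unfolding c_def by blast
    define g where "g = (\<Prod>i\<in>{1..n}. [:c0 i, 1 - c0 i:])"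
    have "c 0 = c0" unfolding c_def by simp
    then have "poly f 0 \<noteq> 0" using f[of 0] F(2) mci_class_const_eq_zero[of n a "poly f 0"] by metis
    moreover have "poly g 1 \<noteq> 0" unfolding g_def by (simp add: poly_prod)
    ultimately have "f * g \<noteq> 0" by auto
    then have "finite {t. poly (f * g) t = 0}" by (rule poly_roots_finite)
    then obtain t where t: "poly (f * g) t \<noteq> 0"
      using infinite_UNIV_alg_closed by (metis (mono_tags, lifting) UNIV_I ex_new_if_finite mem_Collect_eq)
    have "F (?l (c t)) \<noteq> \<zero>\<^bsub>?A\<^esub>" unfolding f mci_class_const_eq_zero using t by simp
    then have "?l (c t) \<in> U" using S(2) F(1) mci_component_one[where ?'k = 'k, of n a] by blast
    moreover have "c t i \<noteq> 0" if "i \<in> {1..n}" for i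
      using t that unfolding g_def c_def by (auto simp: poly_prod)
    ultimately show ?thesis using torus U(3) by blast
  qed
  show "weak_lefschetz ?A ?K (mci_component n a)" if nim: "nim_condition {1..n} a"
  proof -
    \<comment> \<open>Coordinates with \<open>a i = 0\<close> do not descend to the quotient, so the
      product leaves them out.\<close>
    define T where "T = {i \<in> {1..n}. a i \<noteq> 0}"
    obtain F where F: "F \<in> polynomial_functions ?A ?K (mci_component n a 1)"
      "\<And>c. F (?l c) = mci_class n a (mpoly_const (\<Prod>i\<in>T. c i))"
      using coordinate_product_polynomial_function[of T n a] unfolding T_def by auto
    define U where "U = {v \<in> mci_component n a 1. F v \<noteq> \<zero>\<^bsub>?A\<^esub>}"
    have "zariski_closed ?A ?K (mci_component n a 1) (mci_component n a 1 - U)"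
      unfolding zariski_closed_def U_def by (rule exI[of _ "{F}"]) (use F(1) in auto)
    moreover have "?l (\<lambda>_. 1) \<in> U"
      unfolding U_def mci_component_one using F(2)[of "\<lambda>_. 1"] by (simp add: mci_class_const_eq_zero)
    moreover have "P v" if "v \<in> U" for v
    proof -
      obtain c where c: "v = ?l c" using \<open>v \<in> U\<close> unfolding U_def mci_component_one by blast
      have "(\<Prod>i\<in>T. c i) \<noteq> 0" using \<open>v \<in> U\<close> F(2)[of c] unfolding U_def c by (auto simp: mci_class_const_eq_zero)
      then have cT: "c i \<noteq> 0" if "i \<in> T" for i using that unfolding T_def by auto
      \<comment> \<open>A variable with \<open>a i = 0\<close> is zero in the quotient, so resetting
        its coefficient to 1 does not change \<open>v\<close> and moves the form into the
        torus.\<close>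
      define c' where "c' i = (if a i = 0 then 1 else c i)" for i
      have "linear_form {1..n} c - linear_form {1..n} c' = (\<Sum>i\<in>{1..n}. monom_at i 1 (c i - c' i))"
        unfolding linear_form_def by (simp add: sum_subtractf single_diff)
      also have "\<dots> \<in> monomial_ideal {1..n} (\<lambda>i. Suc (a i))"
      proof (rule monomial_ideal_sum)
        fix i assume "i \<in> {1..n}"
        then show "monom_at i 1 (c i - c' i) \<in> monomial_ideal {1..n} (\<lambda>i. Suc (a i))"
          by (cases "a i = 0") (auto simp: c'_def intro!: monom_at_in_monomial_ideal)
      qed
      finally have "v = ?l c'"
        unfolding c using mci_class_eq_iff[OF piece_carrier[OF piece_linear_form] piece_carrier[OF piece_linear_form]] by blast
      moreover have "P (?l c')" by (subst torus) (use cT nim in \<open>auto simp: c'_def T_def\<close>)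
      ultimately show ?thesis by simp
    qed
    ultimately show ?thesis unfolding wl generically_def by (intro exI[of _ U]) (auto simp: U_def)
  qed
qed

section \<open>From digit parities and \<open>tau\<close> to Nim-sums and \<theta>\<close>

lemma bit_foldr_xor:
  "bit (foldr xor xs (0::nat)) p \<longleftrightarrow> odd (\<Sum>x\<leftarrow>xs. of_bool (bit x p) :: nat)"
  by (induction xs) (auto simp: bit_xor_iff)

lemma less_power_two_iff_bits: "(x::nat) < 2 ^ m \<longleftrightarrow> (\<forall>p\<ge>m. \<not> bit x p)"
proof
  assume "\<forall>p\<ge>m. \<not> bit x p"
  then have "take_bit m x = x" by (intro bit_eqI) (metis bit_take_bit_iff not_le)
  then show "x < 2 ^ m" by (metis take_bit_nat_less_exp)
qed (use not_bit_ge in blast)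

lemma nim_below_iff: "nim_below {1..n} m a \<longleftrightarrow> nim_sum n a < 2 ^ m"
proof -
  have "(\<Sum>x\<leftarrow>map a [1..<Suc n]. of_bool (bit x p) :: nat) = (\<Sum>i\<in>{1..n}. of_bool (bit (a i) p))" for p
    by (simp only: map_map comp_def interv_sum_list_conv_sum_set_nat atLeastLessThanSuc_atLeastAtMost set_upt)
  then show ?thesis
    unfolding nim_below_def less_power_two_iff_bits nim_sum_def bit_foldr_xor by simp
qed

text \<open>The branches r and 2q - 2 - r cross at r = q - 1, so the finite values are the smaller
  of the two.\<close>

lemma theta_eq:
  assumes "1 \<le> q"
  shows "theta (int q) (int x) = (if x mod (2 * q) = 2 * q - 1 then - \<infinity> else ereal (of_int (tau q x)))"
proof -
  define r where "r = x mod (2 * q)"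
  have r: "int x mod (2 * int q) = int r" "r < 2 * q" unfolding r_def using assms by (simp_all add: zmod_int)
  show ?thesis
    unfolding theta_def Let_def tau_def r_def[symmetric] r(1) using r(2) assms by (auto simp: min_def)
qed

lemma sum_theta_le_iff:
  assumes "1 \<le> q" "finite V"
  shows "(\<Sum>i\<in>V. theta (int q) (int (a i))) \<le> ereal (2 * real q - 2) \<longleftrightarrow>
    (\<exists>i\<in>V. a i mod (2 * q) = 2 * q - 1) \<or> (\<Sum>i\<in>V. tau q (a i)) \<le> 2 * int q - 2"
proof (cases "\<exists>i\<in>V. a i mod (2 * q) = 2 * q - 1")
  case True
  then obtain i where i: "i \<in> V" "a i mod (2 * q) = 2 * q - 1" by blast
  \<comment> \<open>In \<open>ereal\<close> the sum of \<infinity> and -\<infinity> is \<infinity>,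
    so \<infinity> has to be ruled out for the other summands before the single -\<infinity>
    decides.\<close>
  have "(\<Sum>i\<in>V - {i}. theta (int q) (int (a i))) \<noteq> \<infinity>"
    by (simp add: sum_Pinfty theta_eq[OF assms(1)])
  then have "(\<Sum>i\<in>V. theta (int q) (int (a i))) = - \<infinity>"
    using sum.remove[OF assms(2) i(1), of "\<lambda>i. theta (int q) (int (a i))"] i(2)
    by (simp add: theta_eq[OF assms(1)])
  then show ?thesis using True by simp
next
  case False
  then have "(\<Sum>i\<in>V. theta (int q) (int (a i))) = (\<Sum>i\<in>V. ereal (of_int (tau q (a i))))"
    by (intro sum.cong) (auto simp: theta_eq[OF assms(1)])
  also have "\<dots> = ereal (of_int (\<Sum>i\<in>V. tau q (a i)))" by simp
  also have "\<dots> \<le> ereal (2 * real q - 2) \<longleftrightarrow> (\<Sum>i\<in>V. tau q (a i)) \<le> 2 * int q - 2"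
  proof -
    have "2 * real q - 2 = of_int (2 * int q - 2)" by simp
    then show ?thesis unfolding ereal_less_eq(3) by (simp only: of_int_le_iff)
  qed
  finally show ?thesis using False by simp
qed

theorem theorem8p1:
  fixes n :: nat and a :: "nat \<Rightarrow> nat"
  assumes "CHAR('k::alg_closed_field) = 2"
  shows "weak_lefschetz (mci_ring n a :: 'k mpoly set ring) (mci_scalars n a) (mci_component n a)
    \<longleftrightarrow> (\<forall>q::nat. (\<exists>k\<ge>1. q = 2 ^ k) \<and> 2 * q > nim_sum n a \<longrightarrow>
          (\<Sum>i = 1..n. theta (int q) (int (a i))) \<le> ereal (2 * real q - 2))"
proof -
  have "of_nat CHAR('k) = (0::'k)" by (rule of_nat_CHAR)
  then have two: "(2::'k) = 0" using assms by simp
  define S where "S q \<longleftrightarrow> (\<Sum>i = 1..n. theta (int q) (int (a i))) \<le> ereal (2 * real q - 2)" for q :: nat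
  have "S (2 ^ k) \<longleftrightarrow> (\<exists>i\<in>{1..n}. a i mod 2 ^ Suc k = 2 ^ Suc k - 1) \<or>
      (\<Sum>i = 1..n. tau (2 ^ k) (a i)) \<le> 2 * 2 ^ k - 2" for k
    unfolding S_def by (subst sum_theta_le_iff) simp_all
  then have "weak_lefschetz (mci_ring n a :: 'k mpoly set ring) (mci_scalars n a) (mci_component n a) \<longleftrightarrow>
      (\<forall>k\<ge>1. nim_sum n a < 2 ^ Suc k \<longrightarrow> S (2 ^ k))"
    unfolding weak_lefschetz_iff_nim_condition[OF two] nim_condition_def nim_below_iff by simp
  also have "\<dots> \<longleftrightarrow> (\<forall>q. (\<exists>k\<ge>1. q = 2 ^ k) \<and> 2 * q > nim_sum n a \<longrightarrow> S q)"
    by auto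
  finally show ?thesis unfolding S_def .
qed

end
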